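(* Let $G=(V,E)$ be a DAG. There exists a collection of parental orders $O=(<_v)_{v\in V}$ such that the computation of the joint density of the PCBN with structure $(G,O)$ does not require integration if and only if $G$ contains no active cycles and no interfering v-structures.
   Context: Graphs. $G=(V,E)$ is a finite directed acyclic graph (DAG) without loops or multiple arcs. $w\to v$ means that the arc from $w$ to $v$ is in $E$; then $w$ is a parent of $v$ and $v$ a child of $w$. $pa(v)$, $ch(v)$, $de(v)$ are the sets of parents, children and descendants of $v$ (nodes reachable from $v$ by a directed path). Two nodes are adjacent if there is an arc between them in some direction. A trail $v_1\rightleftharpoons\cdots\rightleftharpoons v_n$ is a sequence of distinct nodes whose consecutive nodes are adjacent. It has a converging connection (v-structure) at $v_i$ ($1<i<n$) if $v_{i-1}\to v_i\leftarrow v_{i+1}$; otherwise the connection at $v_i$ is serial or diverging. A chord of a (possibly closed) trail is an arc between two non-consecutive nodes of it. For disjoint $S,Y,Z\subseteq V$, a trail from $S$ to $Y$ is blocked by $Z$ if it contains a node $v_i$ such that either the trail has a converging connection at $v_i$ and $\{v_i\}\cup de(v_i)$ is disjoint from $Z$, or the trail has no converging connection at $v_i$ and $v_i\in Z$; otherwise it is activated by $Z$. $\mathrm{dsep}(S,Y|Z)$ means that every trail from a node of $S$ to a node of $Y$ is blocked by $Z$; it holds by convention if $S$ or $Y$ is empty. Braces around singletons are omitted. Active cycle. $G$ contains an active cycle if there are a node $v$, distinct parents $w,z\in pa(v)$ and a trail $w\rightleftharpoons x_1\rightleftharpoons\cdots\rightleftharpoons x_n\rightleftharpoons z$ with $n\ge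 1$, having only serial or diverging connections, such that the closed trail $v\leftarrow w\rightleftharpoons x_1\rightleftharpoons\cdots\rightleftharpoons x_n\rightleftharpoons z\to v$ has no chords. Interfering v-structures. $G$ contains interfering v-structures if there are nodes $v_1,\dots,v_5\in V$ with $v_3\to v_4$, $v_3\to v_5$, $v_1\to v_3$, $v_1\to v_4$, $v_1\not\to v_5$, $v_2\to v_3$, $v_2\to v_5$, $v_2\not\to v_4$. PCBN. A parental order $<_v$ is a total order on $pa(v)$; for $w\in pa(v)$, $pa(v\downarrow w)=\{z\in pa(v): z<_v w\}$. A pair-copula Bayesian network (PCBN) has a structure $(G,O)$, $O=(<_v)_{v\in V}$, arbitrary univariate densities $(f_v)_{v\in V}$, and arbitrary bivariate (conditional) copulas $C_{w,v|pa(v\downarrow w)}$, one for each arc $w\to v$. Its joint density is the product of the marginal densities and of the joint copula density $c(\mathbf u)=\prod_{v\in V}\prod_{w\in pa(v)} c_{w,v|pa(v\downarrow w)}(u_{w|pa(v\downarrow w)},u_{v|pa(v\downarrow w)}\,|\,\mathbf u_{pa(v\downarrow w)})$, where $u_{v|S}=\mathbb P(U_v\le u_v|\mathbf U_S=\mathbf u_S)$ (a "conditional margin"). Specified copulas. For distinct $w,v\in V$ and $K\subseteq V\setminus\{w,v\}$, the copula $C_{w,v|K}$ (identified with $C_{v,w|K}$) is specified if, for one of the two ways of naming the pair, one of the following holds: (i) $w\to v$ and $K=pa(v\downarrow w)$; (ii) $\mathrm{dsep}(w,v|K)$; (iii) $w\to v$ and $K=pa(v\downarrow w)\sqcup J$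 with $J\ne\emptyset$ and $\mathrm{dsep}(v,J\,|\,pa(v\downarrow w)\sqcup\{w\})$. Recursions. For $v\in V$, $K\subseteq V\setminus\{v\}$, the set of recursions $\mathcal R(v|K)$ is defined by $\mathcal R(v|\emptyset)=\{u_v\}$ and $\mathcal R(v|K)=\bigsqcup_{k\in K}\{(u_{v|K},k,C_{v,k|K\setminus k},R_v,R_k): R_v\in\mathcal R(v|K\setminus k),\ R_k\in\mathcal R(k|K\setminus k)\}$. A recursion is proper if all copulas appearing in it (including recursively in $R_v,R_k$) are specified. $u_{v|K}$ does not require integration if there is a proper recursion in $\mathcal R(v|K)$; otherwise it requires integration. The computation of the joint density does not require integration if none of the conditional margins $u_{w|pa(v\downarrow w)}$, $u_{v|pa(v\downarrow w)}$ ($v\in V$, $w\in pa(v)$) appearing in the factorization of $c$ requires integration; otherwise it requires integration. *)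

theory Defs
  imports Main "HOL-Library.Uprod"
begin

section \<open>Graphs\<close>

text \<open>A digraph is a node set \<open>V\<close> with an arc relation \<open>E\<close>; \<open>(w, v) \<in> E\<close> is the arc
  from \<open>w\<close> to \<open>v\<close>. Loops are excluded by acyclicity, multiple arcs by the encoding.\<close>

definition dag :: "'a set \<Rightarrow> 'a rel \<Rightarrow> bool" where
  "dag V E \<longleftrightarrow> finite V \<and> E \<subseteq> V \<times> V \<and> acyclic E"

definition pa :: "'a rel \<Rightarrow> 'a \<Rightarrow> 'a set" where
  "pa E v = {w. (w, v) \<in> E}"

definition de :: "'a rel \<Rightarrow> 'a \<Rightarrow> 'a set" where
  "de E v = {u. (v, u) \<in> E\<^sup>+}"

definition adjacent :: "'a rel \<Rightarrow> 'a \<Rightarrow> 'a \<Rightarrow> bool" where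
  "adjacent E u v \<longleftrightarrow> (u, v) \<in> E \<or> (v, u) \<in> E"

definition trail :: "'a rel \<Rightarrow> 'a list \<Rightarrow> bool" where
  "trail E p \<longleftrightarrow> p \<noteq> [] \<and> distinct p \<and> successively (adjacent E) p"

text \<open>Positions are counted from 0; only interior nodes can carry a converging connection.\<close>

definition converging_at :: "'a rel \<Rightarrow> 'a list \<Rightarrow> nat \<Rightarrow> bool" where
  "converging_at E p i \<longleftrightarrow> 0 < i \<and> Suc i < length p \<and>
     (p ! (i - 1), p ! i) \<in> E \<and> (p ! Suc i, p ! i) \<in> E"

definition blocked :: "'a rel \<Rightarrow> 'a list \<Rightarrow> 'a set \<Rightarrow> bool" where
  "blocked E p Z \<longleftrightarrow> (\<exists>i < length p.
     (converging_at E p i \<and> ({p ! i} \<union> de E (p ! i)) \<inter> Z = {}) \<or>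
     (\<not> converging_at E p i \<and> p ! i \<in> Z))"

text \<open>Only used for pairwise disjoint \<open>S\<close>, \<open>Y\<close>, \<open>Z\<close>; true if \<open>S\<close> or \<open>Y\<close> is empty.\<close>

definition dsep :: "'a rel \<Rightarrow> 'a set \<Rightarrow> 'a set \<Rightarrow> 'a set \<Rightarrow> bool" where
  "dsep E S Y Z \<longleftrightarrow> (\<forall>p. trail E p \<and> hd p \<in> S \<and> last p \<in> Y \<longrightarrow> blocked E p Z)"

text \<open>A closed trail is given by the list of its distinct nodes. The first and the last node
  count as consecutive, so the arc joining them is not a chord.\<close>

definition closed_trail_has_chord :: "'a rel \<Rightarrow> 'a list \<Rightarrow> bool" where
  "closed_trail_has_chord E c \<longleftrightarrow> (\<exists>i j. i < j \<and> j < length c \<and>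
     j \<noteq> Suc i \<and> \<not> (i = 0 \<and> Suc j = length c) \<and> adjacent E (c ! i) (c ! j))"

definition has_active_cycle :: "'a set \<Rightarrow> 'a rel \<Rightarrow> bool" where
  "has_active_cycle V E \<longleftrightarrow> (\<exists>v \<in> V. \<exists>w \<in> pa E v. \<exists>z \<in> pa E v. \<exists>xs.
     w \<noteq> z \<and> xs \<noteq> [] \<and> v \<notin> set xs \<and>
     trail E (w # xs @ [z]) \<and>
     (\<forall>i. \<not> converging_at E (w # xs @ [z]) i) \<and>
     \<not> closed_trail_has_chord E (v # w # xs @ [z]))"

definition has_interfering_v_structures :: "'a set \<Rightarrow> 'a rel \<Rightarrow> bool" where
  "has_interfering_v_structures V E \<longleftrightarrow>
     (\<exists>v1 \<in> V. \<exists>v2 \<in> V. \<exists>v3 \<in> V. \<exists>v4 \<in> V. \<exists>v5 \<in> V.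
        (v3, v4) \<in> E \<and> (v3, v5) \<in> E \<and>
        (v1, v3) \<in> E \<and> (v1, v4) \<in> E \<and> (v1, v5) \<notin> E \<and>
        (v2, v3) \<in> E \<and> (v2, v5) \<in> E \<and> (v2, v4) \<notin> E)"

section \<open>Structure of a pair-copula Bayesian network\<close>

text \<open>\<open>(z, w) \<in> ord v\<close> means that \<open>z\<close> precedes \<open>w\<close> in the (strict) parental order of \<open>v\<close>.\<close>

definition parental_orders :: "'a set \<Rightarrow> 'a rel \<Rightarrow> ('a \<Rightarrow> 'a rel) \<Rightarrow> bool" where
  "parental_orders V E ord \<longleftrightarrow> (\<forall>v \<in> V.
     ord v \<subseteq> pa E v \<times> pa E v \<and> strict_linear_order_on (pa E v) (ord v))"

definition pa_below :: "'a rel \<Rightarrow> ('a \<Rightarrow> 'a rel) \<Rightarrow> 'a \<Rightarrow> 'a \<Rightarrow> 'a set" where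
  "pa_below E ord v w = {z \<in> pa E v. (z, w) \<in> ord v}"

text \<open>Since the marginal densities and the copulas of a PCBN are arbitrary, whether integration
  is required depends on the structure alone. Conditional margins and copulas are therefore
  formal symbols: \<open>Margin v K\<close> is \<open>u\<^bsub>v|K\<^esub>\<close>, and \<open>Copula (Upair w v) K\<close> is \<open>C\<^bsub>w,v|K\<^esub>\<close>, where
  the unordered pair identifies \<open>C\<^bsub>w,v|K\<^esub>\<close> with \<open>C\<^bsub>v,w|K\<^esub>\<close>.\<close>

datatype 'a margin = Margin 'a "'a set"

datatype 'a copula = Copula "'a uprod" "'a set"

text \<open>The existential quantifiers over \<open>w\<close> and \<open>v\<close> range over both ways of naming the pair.\<close>

definition specified :: "'a set \<Rightarrow> 'a rel \<Rightarrow> ('a \<Rightarrow> 'a rel) \<Rightarrow> 'a copula \<Rightarrow> bool" where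
  "specified V E ord C \<longleftrightarrow> (\<exists>w v K. C = Copula (Upair w v) K \<and>
     w \<in> V \<and> v \<in> V \<and> w \<noteq> v \<and> K \<subseteq> V - {w, v} \<and>
     ((w, v) \<in> E \<and> K = pa_below E ord v w \<or>
      dsep E {w} {v} K \<or>
      (w, v) \<in> E \<and> (\<exists>J. K = pa_below E ord v w \<union> J \<and> pa_below E ord v w \<inter> J = {} \<and>
         J \<noteq> {} \<and> dsep E {v} J (pa_below E ord v w \<union> {w}))))"

section \<open>Recursions\<close>

datatype 'a recursion =
    Unconditional "'a margin"
  | Step "'a margin" 'a "'a copula" "'a recursion" "'a recursion"

inductive is_recursion :: "'a \<Rightarrow> 'a set \<Rightarrow> 'a recursion \<Rightarrow> bool" where
  "is_recursion v {} (Unconditional (Margin v {}))"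
| "k \<in> K \<Longrightarrow> is_recursion v (K - {k}) Rv \<Longrightarrow> is_recursion k (K - {k}) Rk \<Longrightarrow>
     is_recursion v K (Step (Margin v K) k (Copula (Upair v k) (K - {k})) Rv Rk)"

definition recursions :: "'a \<Rightarrow> 'a set \<Rightarrow> 'a recursion set" where
  "recursions v K = {R. is_recursion v K R}"

primrec copulas_of :: "'a recursion \<Rightarrow> 'a copula set" where
  "copulas_of (Unconditional u) = {}"
| "copulas_of (Step u k C Rv Rk) = {C} \<union> copulas_of Rv \<union> copulas_of Rk"

definition proper :: "'a set \<Rightarrow> 'a rel \<Rightarrow> ('a \<Rightarrow> 'a rel) \<Rightarrow> 'a recursion \<Rightarrow> bool" where
  "proper V E ord R \<longleftrightarrow> (\<forall>C \<in> copulas_of R. specified V E ord C)"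

primrec margin_requires_integration ::
    "'a set \<Rightarrow> 'a rel \<Rightarrow> ('a \<Rightarrow> 'a rel) \<Rightarrow> 'a margin \<Rightarrow> bool" where
  "margin_requires_integration V E ord (Margin v K) \<longleftrightarrow>
     \<not> (\<exists>R \<in> recursions v K. proper V E ord R)"

text \<open>The conditional margins at which the factors
  \<open>c\<^bsub>w,v|pa(v\<down>w)\<^esub>(u\<^bsub>w|pa(v\<down>w)\<^esub>, u\<^bsub>v|pa(v\<down>w)\<^esub> | \<dots>)\<close> of the joint copula density are evaluated.\<close>

definition density_margins :: "'a set \<Rightarrow> 'a rel \<Rightarrow> ('a \<Rightarrow> 'a rel) \<Rightarrow> 'a margin set" where
  "density_margins V E ord = (\<Union>v \<in> V. \<Union>w \<in> pa E v.
     {Margin w (pa_below E ord v w), Margin v (pa_below E ord v w)})"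

definition density_requires_integration :: "'a set \<Rightarrow> 'a rel \<Rightarrow> ('a \<Rightarrow> 'a rel) \<Rightarrow> bool" where
  "density_requires_integration V E ord \<longleftrightarrow>
     (\<exists>u \<in> density_margins V E ord. margin_requires_integration V E ord u)"

end

theory Submission
  imports Defs
begin

text \<open>Every recursion of \<open>u\<^bsub>x|K\<^esub>\<close> contains a copula of each pair of nodes of \<open>K \<union> {x}\<close>,
  conditioned on a subset of \<open>K \<union> {x}\<close>. Neither an active cycle nor interfering v-structures leave a
  specified copula for a suitable pair, whatever the orders are.

  Conversely, suppose that there are none. Call a node set \<open>S\<close> good if any two nodes of \<open>S\<close> joined by a
  trek (a walk without converging connections) with interior outside \<open>S\<close> are adjacent, and if
  \<open>pa(b) \<inter> S\<close> is an initial segment of \<open><\<^sub>b\<close> for all \<open>b \<in> S\<close>. Absence of active cycles makes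
  parent sets good; absence of interfering v-structures makes the sets \<open>pa(v) \<inter> pa(c)\<close>, \<open>c\<close> a
  child of \<open>v\<close>, a chain. A good set strictly inside another one can be enlarged by one node at a time, so
  in topological order every \<open>pa(v)\<close> can be ordered such that all initial segments are good and each
  \<open>pa(v) \<inter> pa(c)\<close> is one of them. In a good set a node without descendants is d-separated from its
  non-parents by its parents, and this yields a proper recursion of \<open>u\<^bsub>w|S - w\<^esub>\<close> whenever
  \<open>S\<close> and \<open>S - w\<close> are good, by induction on the size of \<open>S\<close>.\<close>

section \<open>Treks\<close>

text \<open>Only the interior nodes of the path have to avoid \<open>S\<close>.\<close>

inductive dpath :: "'a rel \<Rightarrow> 'a set \<Rightarrow> 'a \<Rightarrow> 'a \<Rightarrow> bool" for E S where
  arc: "(x, y) \<in> E \<Longrightarrow> dpath E S x y"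
| step: "(x, z) \<in> E \<Longrightarrow> z \<notin> S \<Longrightarrow> dpath E S z y \<Longrightarrow> dpath E S x y"

text \<open>The apex \<open>t\<close> is an interior node of the walk and therefore has to avoid
  \<open>S\<close> as well.\<close>

definition fork :: "'a rel \<Rightarrow> 'a set \<Rightarrow> 'a \<Rightarrow> 'a \<Rightarrow> bool" where
  "fork E S a b \<longleftrightarrow> (\<exists>t. t \<notin> S \<and> dpath E S t a \<and> dpath E S t b)"

definition trek :: "'a rel \<Rightarrow> 'a set \<Rightarrow> 'a \<Rightarrow> 'a \<Rightarrow> bool" where
  "trek E S a b \<longleftrightarrow> dpath E S a b \<or> dpath E S b a \<or> fork E S a b"

text \<open>In the latent projection of the DAG onto \<open>S\<close>, \<open>dpath\<close> gives
  the directed and \<open>fork\<close> the bidirected edges. The condition says that marginalising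
  out the other nodes links no pair that is not already joined by an arc.\<close>

definition treks_adjacent :: "'a rel \<Rightarrow> 'a set \<Rightarrow> bool" where
  "treks_adjacent E S \<longleftrightarrow> (\<forall>a\<in>S. \<forall>b\<in>S. a \<noteq> b \<longrightarrow> trek E S a b \<longrightarrow> adjacent E a b)"

lemma dpath_trancl: "dpath E S x y \<Longrightarrow> (x, y) \<in> E\<^sup>+"
  by (induction rule: dpath.induct) auto

lemma dpath_trans: "dpath E S x z \<Longrightarrow> z \<notin> S \<Longrightarrow> dpath E S z y \<Longrightarrow> dpath E S x y"
  by (induction rule: dpath.induct) (auto intro: dpath.intros)

lemma dpath_mono: "dpath E S x y \<Longrightarrow> R \<subseteq> S \<Longrightarrow> dpath E R x y"
  by (induction rule: dpath.induct) (auto intro: dpath.intros)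

lemma trancl_imp_dpath_empty: "(x, y) \<in> E\<^sup>+ \<Longrightarrow> dpath E {} x y"
  by (induction rule: converse_trancl_induct) (auto intro: dpath.intros)

text \<open>The path is cut at its last interior node in \<open>T\<close>. Since \<open>T\<close>
  need not contain \<open>S\<close>, this also passes from one avoided set to an unrelated
  one.\<close>

lemma dpath_last:
  "dpath E S x y \<Longrightarrow> dpath E T x y \<or> (\<exists>c\<in>T - S. dpath E S x c \<and> dpath E T c y)"
  by (induction rule: dpath.induct) (auto intro: dpath.intros)

text \<open>The path is cut at its first interior node in \<open>T\<close>, so only the initial
  piece is known to avoid \<open>T\<close>.\<close>

lemma dpath_first:
  "dpath E S x y \<Longrightarrow>
     dpath E (S \<union> T) x y \<or> (\<exists>c\<in>T - S. dpath E (S \<union> T) x c \<and> dpath E S c y)"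
proof (induction rule: dpath.induct)
  case (step x z y)
  then show ?case
    by (cases "z \<in> T") (auto intro: dpath.intros)
qed (auto intro: dpath.intros)

lemma fork_sym: "fork E S a b \<Longrightarrow> fork E S b a"
  by (auto simp: fork_def)

lemma fork_mono: "fork E S a b \<Longrightarrow> R \<subseteq> S \<Longrightarrow> fork E R a b"
  by (auto simp: fork_def intro: dpath_mono)

lemma trek_sym: "trek E S a b \<Longrightarrow> trek E S b a"
  by (auto simp: trek_def intro: fork_sym)

lemma trek_mono: "trek E S a b \<Longrightarrow> R \<subseteq> S \<Longrightarrow> trek E R a b"
  by (auto simp: trek_def intro: dpath_mono fork_mono)

lemma adjacent_sym: "adjacent E a b \<Longrightarrow> adjacent E b a"
  by (auto simp: adjacent_def)

text \<open>A trek is a walk \<open>h 0, \<dots>, h n\<close> that climbs against the arcs up to its top \<open>h m\<close> and then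
  descends along them.\<close>

definition trek_walk :: "'a rel \<Rightarrow> 'a set \<Rightarrow> (nat \<Rightarrow> 'a) \<Rightarrow> nat \<Rightarrow> nat \<Rightarrow> bool" where
  "trek_walk E S h m n \<longleftrightarrow> m \<le> n \<and> (\<forall>l<m. (h (Suc l), h l) \<in> E) \<and>
     (\<forall>l. m \<le> l \<longrightarrow> l < n \<longrightarrow> (h l, h (Suc l)) \<in> E) \<and> (\<forall>l. 0 < l \<longrightarrow> l < n \<longrightarrow> h l \<notin> S)"

section \<open>Treks as walks, and chordless treks between parents\<close>

lemma dpath_imp_fun:
  "dpath E S x y \<Longrightarrow> \<exists>f n. 0 < n \<and> f 0 = x \<and> f n = y \<and>
     (\<forall>l<n. (f l, f (Suc l)) \<in> E) \<and> (\<forall>l. 0 < l \<longrightarrow> l < n \<longrightarrow> f l \<notin> S)"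
proof (induction rule: dpath.induct)
  case (arc x y)
  show ?case
    by (rule exI[of _ "case_nat x (\<lambda>_. y)"], rule exI[of _ 1]) (use arc in auto)
next
  case (step x z y)
  then obtain f n where f: "f 0 = z" "f n = y"
      "\<forall>l<n. (f l, f (Suc l)) \<in> E" "\<forall>l. 0 < l \<longrightarrow> l < n \<longrightarrow> f l \<notin> S"
    by blast
  have "f l \<notin> S" if "l < n" for l
    using f that step.hyps by (cases l) auto
  then show ?case
    by (intro exI[of _ "case_nat x f"] exI[of _ "Suc n"])
      (use f step.hyps in \<open>auto split: nat.splits\<close>)
qed

lemma trek_imp_walk:
  assumes "trek E S a b"
  shows "\<exists>h m n. trek_walk E S h m n \<and> h 0 = a \<and> h n = b"
proof -
  consider "dpath E S a b" | "dpath E S b a" | "fork E S a b"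
    using assms by (auto simp: trek_def)
  then show ?thesis
  proof cases
    case 1
    from dpath_imp_fun[OF this] obtain f n where "f 0 = a" "f n = b"
      "\<forall>l<n. (f l, f (Suc l)) \<in> E" "\<forall>l. 0 < l \<longrightarrow> l < n \<longrightarrow> f l \<notin> S"
      by blast
    then have "trek_walk E S f 0 n \<and> f 0 = a \<and> f n = b"
      by (auto simp: trek_walk_def)
    then show ?thesis by blast
  next
    case 2
    from dpath_imp_fun[OF this] obtain f n where f: "f 0 = b" "f n = a"
      "\<forall>l<n. (f l, f (Suc l)) \<in> E" "\<forall>l. 0 < l \<longrightarrow> l < n \<longrightarrow> f l \<notin> S"
      by blast
    have "(f (n - Suc l), f (n - l)) \<in> E" if "l < n" for l
      using f(3)[rule_format, of "n - Suc l"] that by (simp add: Suc_diff_Suc)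
    then have "trek_walk E S (\<lambda>l. f (n - l)) n n"
      using f(4) by (auto simp: trek_walk_def)
    then show ?thesis using f(1,2)
      by (intro exI[of _ "\<lambda>l. f (n - l)"] exI[of _ n]) auto
  next
    case 3
    then obtain t where t: "t \<notin> S" "dpath E S t a" "dpath E S t b"
      by (auto simp: fork_def)
    from dpath_imp_fun[OF t(2)] obtain f m where f: "f 0 = t" "f m = a"
      "\<forall>l<m. (f l, f (Suc l)) \<in> E" "\<forall>l. 0 < l \<longrightarrow> l < m \<longrightarrow> f l \<notin> S" "0 < m"
      by blast
    from dpath_imp_fun[OF t(3)] obtain g n where g: "g 0 = t" "g n = b"
      "\<forall>l<n. (g l, g (Suc l)) \<in> E" "\<forall>l. 0 < l \<longrightarrow> l < n \<longrightarrow> g l \<notin> S" "0 < n"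
      by blast
    \<comment> \<open>The leg to \<open>a\<close> is read backwards, which puts the apex at position
      \<open>m\<close>.\<close>
    define h where "h l = (if l \<le> m then f (m - l) else g (l - m))" for l
    have "(h (Suc l), h l) \<in> E" if "l < m" for l
      using f(3)[rule_format, of "m - Suc l"] that by (simp add: h_def Suc_diff_Suc)
    moreover have "(h l, h (Suc l)) \<in> E" if "m \<le> l" "l < m + n" for l
      using g(3)[rule_format, of "l - m"] that f(1) g(1)
      by (cases "l = m") (auto simp: h_def Suc_diff_le)
    moreover have "h l \<notin> S" if "0 < l" "l < m + n" for l
    proof (cases "l = m")
      case False
      then show ?thesis
        using f(4)[rule_format, of "m - l"] g(4)[rule_format, of "l - m"] that
        by (auto simp: h_def)
    qed (use t(1) f(1) in \<open>auto simp: h_def\<close>)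
    ultimately have "trek_walk E S h m (m + n)"
      by (auto simp: trek_walk_def)
    moreover have "h 0 = a" "h (m + n) = b"
      using f g by (auto simp: h_def)
    ultimately show ?thesis by blast
  qed
qed

lemma trek_walk_up:
  assumes "trek_walk E S h m n" "i < j" "j \<le> m"
  shows "(h j, h i) \<in> E\<^sup>+"
  using assms(2,3)
proof (induction j)
  case (Suc j)
  have "(h (Suc j), h j) \<in> E"
    using assms(1) Suc.prems by (auto simp: trek_walk_def)
  then show ?case using Suc
    by (cases "i = j") (auto intro: trancl_into_trancl2)
qed simp

lemma trek_walk_down:
  assumes "trek_walk E S h m n" "i < j" "m \<le> i" "j \<le> n"
  shows "(h i, h j) \<in> E\<^sup>+"
  using assms(2,3,4)
proof (induction j)
  case (Suc j)
  have "(h j, h (Suc j)) \<in> E"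
    using assms(1) Suc.prems by (auto simp: trek_walk_def)
  then show ?case using Suc
    by (cases "i = j") auto
qed simp

text \<open>The chord replaces the part of the walk that it spans. Acyclicity prevents the chord
  from pointing against the climb or the descent, so the shortened walk again climbs to a single top
  and then descends.\<close>

lemma trek_walk_shortcut:
  assumes "acyclic E" and w: "trek_walk E S h m n"
    and ij: "Suc i < j" "j \<le> n" and adj: "adjacent E (h i) (h j)"
  shows "\<exists>h' m' n'. trek_walk E S h' m' n' \<and> h' 0 = h 0 \<and> h' n' = h n \<and> n' < n"
proof -
  define d where "d = j - Suc i"
  define h' where "h' l = (if l \<le> i then h l else h (l + d))" for l
  have j: "j = Suc i + d" "0 < d" using ij by (auto simp: d_def)
  have up: "\<And>l. l < m \<Longrightarrow> (h (Suc l), h l) \<in> E"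
    and down: "\<And>l. m \<le> l \<Longrightarrow> l < n \<Longrightarrow> (h l, h (Suc l)) \<in> E"
    and avoid: "\<And>l. 0 < l \<Longrightarrow> l < n \<Longrightarrow> h l \<notin> S" and mn: "m \<le> n"
    using w by (auto simp: trek_walk_def)
  have ends: "h' 0 = h 0" "h' (n - d) = h n" "n - d < n"
    using ij j by (auto simp: h'_def)
  have av: "h' l \<notin> S" if "0 < l" "l < n - d" for l
    using that avoid by (auto simp: h'_def)
  from adj consider "(h i, h j) \<in> E" | "(h j, h i) \<in> E"
    by (auto simp: adjacent_def)
  then have "\<exists>m'. trek_walk E S h' m' (n - d)"
  proof cases
    case 1
    have "m \<le> j"
    proof (rule ccontr)
      assume "\<not> m \<le> j"
      then have "(h j, h i) \<in> E\<^sup>+" using trek_walk_up[OF w, of i j] ij by simp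
      with 1 show False using \<open>acyclic E\<close>
        by (meson acyclic_def trancl_into_trancl)
    qed
    \<comment> \<open>If \<open>i < m\<close>, the climb now stops at \<open>h i\<close>, which
      becomes the top.\<close>
    have "trek_walk E S h' (min m i) (n - d)"
      unfolding trek_walk_def
    proof (intro conjI allI impI)
      fix l assume l: "min m i \<le> l" "l < n - d"
      show "(h' l, h' (Suc l)) \<in> E"
      proof (cases "l = i")
        case True then show ?thesis using 1 j by (auto simp: h'_def)
      next
        case False
        then show ?thesis using l down[of l] down[of "l + d"] \<open>m \<le> j\<close> j by (auto simp: h'_def)
      qed
    qed (use up av mn j ij in \<open>auto simp: h'_def\<close>)
    then show ?thesis by blast
  next
    case 2
    have "i \<le> m"
    proof (rule ccontr)
      assume "\<not> i \<le> m"
      then have "(h i, h j) \<in> E\<^sup>+" using trek_walk_down[OF w, of i j] ij by simp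
      with 2 show False using \<open>acyclic E\<close>
        by (meson acyclic_def trancl_into_trancl)
    qed
    \<comment> \<open>In the shortened walk \<open>h j\<close> has position \<open>Suc i\<close>; it
      becomes the top unless the old top lies beyond it.\<close>
    have "trek_walk E S h' (max (Suc i) (m - d)) (n - d)"
      unfolding trek_walk_def
    proof (intro conjI allI impI)
      fix l assume l: "l < max (Suc i) (m - d)"
      show "(h' (Suc l), h' l) \<in> E"
      proof (cases "l = i")
        case True then show ?thesis using 2 j by (auto simp: h'_def)
      next
        case False
        then show ?thesis using l up[of l] up[of "l + d"] \<open>i \<le> m\<close> j by (auto simp: h'_def)
      qed
    next
      fix l assume "max (Suc i) (m - d) \<le> l" "l < n - d"
      then show "(h' l, h' (Suc l)) \<in> E" using down[of "l + d"] j by (auto simp: h'_def)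
    qed (use av mn j ij in \<open>auto simp: h'_def\<close>)
    then show ?thesis by blast
  qed
  then show ?thesis using ends by blast
qed

text \<open>A shortest trek between two parents of \<open>v\<close> has no chord, except possibly
  the arc joining its ends when it is a single arc. Its interior contains no parents of
  \<open>v\<close>, and all its nodes are ancestors of \<open>v\<close>, hence not children. If its
  ends were not adjacent, adding \<open>v\<close> would close an active cycle.\<close>

lemma treks_adjacent_pa:
  assumes dag: "dag V E" and nac: "\<not> has_active_cycle V E" and "v \<in> V"
  shows "treks_adjacent E (pa E v)"
  unfolding treks_adjacent_def
proof (intro ballI impI)
  fix a b assume ab: "a \<in> pa E v" "b \<in> pa E v" "a \<noteq> b" and trek: "trek E (pa E v) a b"
  have acyc: "acyclic E" using dag by (simp add: dag_def)
  let ?W = "\<lambda>n. \<exists>h m. trek_walk E (pa E v) h m n \<and> h 0 = a \<and> h n = b"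
  define n where "n = (LEAST n. ?W n)"
  have "?W n" unfolding n_def by (rule LeastI_ex) (use trek_imp_walk[OF trek] in blast)
  then obtain h m where w: "trek_walk E (pa E v) h m n" and h: "h 0 = a" "h n = b" by blast
  have chordless: "\<not> adjacent E (h i) (h j)" if "Suc i < j" "j \<le> n" for i j
  proof
    assume "adjacent E (h i) (h j)"
    from trek_walk_shortcut[OF acyc w that this] h
    obtain n' where "?W n'" "n' < n" by auto
    then show False unfolding n_def using not_less_Least by blast
  qed
  have up: "\<And>l. l < m \<Longrightarrow> (h (Suc l), h l) \<in> E"
    and down: "\<And>l. m \<le> l \<Longrightarrow> l < n \<Longrightarrow> (h l, h (Suc l)) \<in> E"
    and avoid: "\<And>l. 0 < l \<Longrightarrow> l < n \<Longrightarrow> h l \<notin> pa E v" and mn: "m \<le> n"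
    using w by (auto simp: trek_walk_def)
  have adj: "adjacent E (h l) (h (Suc l))" if "l < n" for l
    using up[of l] down[of l] that by (cases "l < m") (auto simp: adjacent_def)
  have "n \<noteq> 0" using h ab by (intro notI) auto
  \<comment> \<open>A repeated node is adjacent to the neighbours of both of its occurrences, which
    contradicts the absence of chords; so no separate shortening of walks with repetitions is
    required.\<close>
  have inj: "h i \<noteq> h j" if "i < j" "j \<le> n" for i j
  proof
    assume eq: "h i = h j"
    show False
    proof (cases "j < n")
      case True
      then show False using chordless[of i "Suc j"] adj[of j] eq that by simp
    next
      case False
      then have "j = n" using that by simp
      then have "0 < i" using eq h ab by (cases i) auto
      then obtain i' where "i = Suc i'" by (cases i) auto
      then show False using chordless[of i' j] adj[of i'] eq that by simp
    qed
  qed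
  have anc: "(h l, v) \<in> E\<^sup>+" if "l \<le> n" for l
  proof -
    have "(a, v) \<in> E" "(b, v) \<in> E" using ab by (auto simp: pa_def)
    moreover have "l = 0 \<or> l = n \<or> (h l, h 0) \<in> E\<^sup>+ \<or> (h l, h n) \<in> E\<^sup>+"
      using trek_walk_up[OF w, of 0 l] trek_walk_down[OF w, of l n] that by fastforce
    ultimately show ?thesis using h by (auto intro: trancl_into_trancl)
  qed
  show "adjacent E a b"
  proof (rule ccontr)
    assume nadj: "\<not> adjacent E a b"
    have "n \<noteq> 1" using adj[of 0] h nadj by auto
    with \<open>n \<noteq> 0\<close> have n2: "2 \<le> n" by simp
    define xs where "xs = map h [1..<n]"
    have upt: "[0..<Suc n] = 0 # [1..<n] @ [n]"
      using n2 by (simp add: upt_conv_Cons)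
    have p: "a # xs @ [b] = map h [0..<Suc n]"
      unfolding upt xs_def using h by simp
    have nth: "(a # xs @ [b]) ! l = h l" if "l \<le> n" for l
      unfolding p using that by (simp del: upt_Suc)
    have len: "length (a # xs @ [b]) = Suc n" unfolding p by simp
    have "xs \<noteq> []" using n2 by (simp add: xs_def)
    moreover have "v \<notin> set xs"
    proof
      assume "v \<in> set xs"
      then obtain l where "l < n" "v = h l" by (auto simp: xs_def)
      then show False using anc[of l] acyc by (simp add: acyclic_def)
    qed
    moreover have "trail E (a # xs @ [b])"
    proof -
      have "distinct (a # xs @ [b])"
        unfolding distinct_conv_nth len
      proof (intro allI impI)
        fix i j assume ij: "i < Suc n" "j < Suc n" "i \<noteq> j"
        then have "i \<le> n" "j \<le> n" by auto
        then have "h i \<noteq> h j" using inj[of i j] inj[of j i] ij by (cases "i < j") auto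
        then show "(a # xs @ [b]) ! i \<noteq> (a # xs @ [b]) ! j"
          unfolding nth[OF \<open>i \<le> n\<close>] nth[OF \<open>j \<le> n\<close>] .
      qed
      moreover have "successively (adjacent E) (a # xs @ [b])"
        unfolding successively_conv_nth len
      proof (intro allI impI)
        fix i assume "Suc i < Suc n"
        then have i: "i \<le> n" "Suc i \<le> n" "i < n" by auto
        show "adjacent E ((a # xs @ [b]) ! i) ((a # xs @ [b]) ! Suc i)"
          unfolding nth[OF i(1)] nth[OF i(2)] using adj[OF i(3)] .
      qed
      ultimately show ?thesis by (auto simp: trail_def)
    qed
    moreover have "\<not> converging_at E (a # xs @ [b]) i" for i
    proof
      assume "converging_at E (a # xs @ [b]) i"
      then have c: "0 < i" "Suc i < Suc n"
          "((a # xs @ [b]) ! (i - 1), (a # xs @ [b]) ! i) \<in> E"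
          "((a # xs @ [b]) ! Suc i, (a # xs @ [b]) ! i) \<in> E"
        unfolding converging_at_def len by auto
      then have l: "i - 1 \<le> n" "i \<le> n" "Suc i \<le> n" by auto
      have i: "0 < i" "i < n" "(h (i - 1), h i) \<in> E" "(h (Suc i), h i) \<in> E"
        using c unfolding nth[OF l(1)] nth[OF l(2)] nth[OF l(3)] by auto
      then obtain k where k: "i = Suc k" by (cases i) auto
      have no2: "(y, x) \<notin> E" if "(x, y) \<in> E" for x y
        using that acyc trancl_into_trancl[of x y E x] by (auto simp: acyclic_def)
      \<comment> \<open>Each interior node sends an arc to its predecessor (below the top) or to its
        successor (from the top on), so it is no collider.\<close>
      have "(h i, h k) \<in> E \<or> (h i, h (Suc i)) \<in> E"
        using up[of k] down[of i] i(2) k by (cases "k < m") auto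
      then show False using i(3,4) k no2 by auto
    qed
    moreover have "\<not> closed_trail_has_chord E (v # a # xs @ [b])"
    proof
      assume "closed_trail_has_chord E (v # a # xs @ [b])"
      then obtain i j where ij: "i < j" "j < Suc (Suc n)" "j \<noteq> Suc i"
          "\<not> (i = 0 \<and> Suc j = Suc (Suc n))"
          and ch: "adjacent E ((v # a # xs @ [b]) ! i) ((v # a # xs @ [b]) ! j)"
        using len by (auto simp: closed_trail_has_chord_def)
      obtain j' where j: "j = Suc j'" using ij by (cases j) auto
      have j'n: "j' \<le> n" using ij j by simp
      have ej: "(v # a # xs @ [b]) ! j = h j'"
        unfolding j nth_Cons_Suc using nth[OF j'n] .
      show False
      proof (cases i)
        case 0
        then have "adjacent E v (h j')" using ch ej by simp
        moreover have "(h j', v) \<notin> E" using avoid[of j'] ij j 0 by (auto simp: pa_def)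
        moreover have "(v, h j') \<notin> E"
          using anc[of j'] ij j acyc by (auto simp: acyclic_def intro: trancl_into_trancl2)
        ultimately show False by (auto simp: adjacent_def)
      next
        case (Suc i')
        have i'n: "i' \<le> n" using ij j Suc by simp
        have "(v # a # xs @ [b]) ! i = h i'"
          unfolding Suc nth_Cons_Suc using nth[OF i'n] .
        then have "adjacent E (h i') (h j')" using ch ej by simp
        then show False using chordless[of i' j'] ij j Suc by simp
      qed
    qed
    ultimately have "has_active_cycle V E"
      unfolding has_active_cycle_def using ab \<open>v \<in> V\<close> by blast
    then show False using nac by simp
  qed
qed

section \<open>Good node sets and d-separation\<close>

definition initial :: "'a rel \<Rightarrow> ('a \<Rightarrow> 'a rel) \<Rightarrow> 'a \<Rightarrow> 'a set \<Rightarrow> bool" where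
  "initial E ord b K \<longleftrightarrow> K \<subseteq> pa E b \<and> (\<forall>x\<in>K. \<forall>y. (y, x) \<in> ord b \<longrightarrow> y \<in> K)"

definition good :: "'a set \<Rightarrow> 'a rel \<Rightarrow> ('a \<Rightarrow> 'a rel) \<Rightarrow> 'a set \<Rightarrow> bool" where
  "good V E ord S \<longleftrightarrow>
     S \<subseteq> V \<and> treks_adjacent E S \<and> (\<forall>b\<in>S. initial E ord b (pa E b \<inter> S))"

text \<open>Goodness of an initial segment involves \<open>ord\<close> only at parents of
  \<open>v\<close>. Admissibility at \<open>v\<close> thus depends on the orders at \<open>v\<close>
  and its parents alone, which allows the orders to be chosen in topological order.\<close>

definition admissible :: "'a set \<Rightarrow> 'a rel \<Rightarrow> ('a \<Rightarrow> 'a rel) \<Rightarrow> 'a \<Rightarrow> bool" where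
  "admissible V E ord v \<longleftrightarrow>
     ord v \<subseteq> pa E v \<times> pa E v \<and> strict_linear_order_on (pa E v) (ord v) \<and>
     (\<forall>K. initial E ord v K \<longrightarrow> good V E ord K) \<and>
     (\<forall>c. (v, c) \<in> E \<longrightarrow> initial E ord v (pa E v \<inter> pa E c))"

lemma initial_nested:
  assumes "admissible V E ord b" "initial E ord b K" "initial E ord b L"
  shows "K \<subseteq> L \<or> L \<subseteq> K"
proof (rule ccontr)
  assume "\<not> ?thesis"
  then obtain x y where xy: "x \<in> K" "x \<notin> L" "y \<in> L" "y \<notin> K" by blast
  then have "x \<in> pa E b" "y \<in> pa E b" "x \<noteq> y" using assms by (auto simp: initial_def)
  then have "(x, y) \<in> ord b \<or> (y, x) \<in> ord b"
    using assms(1) by (auto simp: admissible_def strict_linear_order_on_def total_on_def)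
  then show False using xy assms(2,3) by (auto simp: initial_def)
qed

lemma initial_Int:
  "initial E ord b K \<Longrightarrow> initial E ord b L \<Longrightarrow> initial E ord b (K \<inter> L)"
  by (auto simp: initial_def)

locale integrable_dag =
  fixes V :: "'a set" and E :: "'a rel"
  assumes dag: "dag V E"
    and no_active_cycle: "\<not> has_active_cycle V E"
    and no_interfering: "\<not> has_interfering_v_structures V E"
begin

lemma acyc: "acyclic E"
  using dag by (simp add: dag_def)

lemma finite_V: "finite V"
  using dag by (simp add: dag_def)

lemma E_sub: "(x, y) \<in> E \<Longrightarrow> x \<in> V \<and> y \<in> V"
  using dag by (auto simp: dag_def)

lemma no_cycle: "(x, x) \<notin> E\<^sup>+"
  using acyc by (auto simp: acyclic_def)

lemma asym: "(x, y) \<in> E \<Longrightarrow> (y, x) \<notin> E\<^sup>+"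
  using no_cycle[of x] trancl_into_trancl2[of x y E x] by blast

lemma finite_E: "finite E"
  using dag by (auto simp: dag_def intro: finite_subset)

lemma wf_E: "wf E"
  by (rule finite_acyclic_wf[OF finite_E acyc])

lemma wf_E_converse: "wf (E\<inverse>)"
  by (rule finite_acyclic_wf_converse[OF finite_E acyc])

lemma pa_V: "pa E v \<subseteq> V"
  using E_sub unfolding pa_def by blast

lemma pa_treks: "v \<in> V \<Longrightarrow> treks_adjacent E (pa E v)"
  by (rule treks_adjacent_pa[OF dag no_active_cycle])

lemma treks_adjacentD:
  "treks_adjacent E S \<Longrightarrow> a \<in> S \<Longrightarrow> b \<in> S \<Longrightarrow> a \<noteq> b \<Longrightarrow> trek E S a b \<Longrightarrow> (a, b) \<in> E \<or> (b, a) \<in> E"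
  by (auto simp: treks_adjacent_def adjacent_def)

lemma dpath_arc:
  assumes "treks_adjacent E S" "a \<in> S" "b \<in> S" "dpath E S a b"
  shows "(a, b) \<in> E"
proof -
  have "(a, b) \<in> E\<^sup>+" using assms(4) by (rule dpath_trancl)
  moreover then have "a \<noteq> b" using no_cycle by auto
  ultimately show ?thesis
    using treks_adjacentD[OF assms(1-3)] assms(4) asym by (auto simp: trek_def)
qed

text \<open>Otherwise \<open>r\<close>, \<open>q\<close>, \<open>y\<close>, \<open>a\<close>,
  \<open>b\<close> would serve as \<open>v1\<close>, ..., \<open>v5\<close> of interfering
  v-structures. So the sets of parents that \<open>y\<close> shares with its children form a
  chain.\<close>

lemma pa_nested:
  assumes "(y, a) \<in> E" "(y, b) \<in> E" "(r, y) \<in> E" "(r, a) \<in> E" "(q, y) \<in> E" "(q, b) \<in> E"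
  shows "(r, b) \<in> E \<or> (q, a) \<in> E"
proof (rule ccontr)
  assume "\<not> ?thesis"
  moreover have "r \<in> V" "q \<in> V" "y \<in> V" "a \<in> V" "b \<in> V"
    using assms E_sub by blast+
  ultimately show False
    using no_interfering assms unfolding has_interfering_v_structures_def by blast
qed

text \<open>A trek avoiding \<open>X \<inter> Y\<close> is cut at its nodes in \<open>X\<close>. The
  pieces between them avoid \<open>X\<close>, hence can be replaced by arcs, and what remains is a
  trek through nodes of \<open>X - Y\<close>, that is, one avoiding \<open>Y\<close>.\<close>

lemma treks_adjacent_Int:
  assumes X: "treks_adjacent E X" and Y: "treks_adjacent E Y"
  shows "treks_adjacent E (X \<inter> Y)"
proof -
  \<comment> \<open>The last interior node in \<open>X\<close> is a parent of \<open>y\<close>, so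
    the induction runs backwards along the arcs of \<open>E\<close>.\<close>
  have dp: "y \<in> X \<Longrightarrow> x \<in> X \<Longrightarrow> dpath E (X \<inter> Y) x y \<Longrightarrow> dpath E Y x y" for x y
  proof (induction y rule: wf_induct_rule[OF wf_E])
    case (1 y)
    from dpath_last[OF 1(4), of X] show ?case
    proof
      assume "dpath E X x y"
      then show ?thesis using dpath_arc[OF X] 1 dpath.arc by metis
    next
      assume "\<exists>c\<in>X - X \<inter> Y. dpath E (X \<inter> Y) x c \<and> dpath E X c y"
      then obtain c where c: "c \<in> X" "c \<notin> Y" "dpath E (X \<inter> Y) x c" "dpath E X c y" by blast
      then have "(c, y) \<in> E" using dpath_arc[OF X] 1 by blast
      then have "dpath E Y x c" "dpath E Y c y" using 1 c by (auto intro: dpath.arc)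
      then show ?thesis using c(2) dpath_trans by metis
    qed
  qed
  have first: "\<exists>c\<in>X. dpath E X t c \<and> (c = y \<or> c \<notin> Y \<and> dpath E Y c y)"
    if "dpath E (X \<inter> Y) t y" "y \<in> X" for t y
  proof -
    have "X \<inter> Y \<union> X = X" by auto
    with dpath_first[OF that(1), of X] show ?thesis using that(2) dp by fastforce
  qed
  have arcs: "trek E Y a b"
    if z: "z1 = a \<or> z1 \<notin> Y \<and> dpath E Y z1 a" "z2 = b \<or> z2 \<notin> Y \<and> dpath E Y z2 b"
      "(z1, z2) \<in> E" for a b z1 z2
  proof -
    have "dpath E Y z1 b" using z by (auto intro: dpath.intros)
    then show ?thesis using z by (auto simp: trek_def fork_def)
  qed
  show ?thesis
    unfolding treks_adjacent_def
  proof (intro ballI impI)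
    fix a b assume ab: "a \<in> X \<inter> Y" "b \<in> X \<inter> Y" "a \<noteq> b" and t: "trek E (X \<inter> Y) a b"
    have "trek E Y a b"
    proof -
      consider "dpath E (X \<inter> Y) a b" | "dpath E (X \<inter> Y) b a" | "fork E (X \<inter> Y) a b"
        using t by (auto simp: trek_def)
      then show ?thesis
      proof cases
        case 3
        then obtain t where t: "t \<notin> X \<inter> Y" "dpath E (X \<inter> Y) t a" "dpath E (X \<inter> Y) t b"
          by (auto simp: fork_def)
        show ?thesis
        proof (cases "t \<in> X")
          case True
          then have "dpath E Y t a" "dpath E Y t b" using dp ab t by auto
          then show ?thesis using True t(1) by (auto simp: trek_def fork_def)
        next
          case False
          \<comment> \<open>\<open>z1\<close> and \<open>z2\<close> are the first nodes of
            \<open>X\<close> on the two legs; the fork between them avoids \<open>X\<close>, so they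
            coincide or are joined by an arc.\<close>
          obtain z1 where z1: "z1 \<in> X" "dpath E X t z1" "z1 = a \<or> z1 \<notin> Y \<and> dpath E Y z1 a"
            using first[OF t(2)] ab by blast
          obtain z2 where z2: "z2 \<in> X" "dpath E X t z2" "z2 = b \<or> z2 \<notin> Y \<and> dpath E Y z2 b"
            using first[OF t(3)] ab by blast
          have "trek E X z1 z2" using False z1 z2 by (auto simp: trek_def fork_def)
          then consider "z1 = z2" | "(z1, z2) \<in> E" | "(z2, z1) \<in> E"
            using treks_adjacentD[OF X z1(1) z2(1)] by blast
          then show ?thesis
          proof cases
            case 1
            then show ?thesis using z1(3) z2(3) ab by (auto simp: trek_def fork_def)
          next
            case 2
            then show ?thesis using arcs z1(3) z2(3) by blast
          next
            case 3
            then show ?thesis using trek_sym[OF arcs[OF z2(3) z1(3)]] by blast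
          qed
        qed
      qed (use dp ab in \<open>auto simp: trek_def\<close>)
    qed
    then show "adjacent E a b" using Y ab by (auto simp: treks_adjacent_def)
  qed
qed

text \<open>A witness \<open>u\<close> that is minimal with respect to \<open>E\<close> works: if \<open>y\<close> and a parent of \<open>u\<close> on the
  other leg were not adjacent, then \<open>u\<close> would close an active cycle.\<close>

lemma fork_apex:
  assumes "(y, a) \<in> E" "fork E S a y" "y \<in> S"
  shows "\<exists>u r. (u = a \<or> u \<notin> S \<and> dpath E S u a) \<and> (y, u) \<in> E \<and>
           r \<notin> S \<and> (r, y) \<in> E \<and> (r, u) \<in> E"
proof -
  define U where "U = {u. (u = a \<or> u \<notin> S \<and> dpath E S u a) \<and> (y, u) \<in> E \<and> fork E S u y}"
  have "a \<in> U" using assms by (auto simp: U_def)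
  then obtain u where u: "u \<in> U" and min: "\<And>x. (x, u) \<in> E \<Longrightarrow> x \<notin> U"
    using wfE_min[OF wf_E] by metis
  have uV: "u \<in> V" using u E_sub unfolding U_def by blast
  let ?P = "pa E u"
  have yP: "y \<in> ?P" using u by (auto simp: U_def pa_def)
  obtain t where t: "t \<notin> S" "dpath E S t u" "dpath E S t y"
    using u by (auto simp: U_def fork_def)
  obtain q where q: "q \<notin> S" "(q, u) \<in> E" "q = t \<or> dpath E S t q"
  proof -
    \<comment> \<open>A path avoiding \<open>UNIV\<close> is a single arc, so the cut is at the last
      interior node.\<close>
    from dpath_last[OF t(2), of UNIV] show ?thesis
    proof
      assume "dpath E UNIV t u"
      then have "(t, u) \<in> E" by cases auto
      then show ?thesis using that t(1) by auto
    next
      assume "\<exists>c\<in>UNIV - S. dpath E S t c \<and> dpath E UNIV c u"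
      then obtain c where c: "c \<notin> S" "dpath E S t c" "dpath E UNIV c u" by blast
      from c(3) have "(c, u) \<in> E" by cases auto
      then show ?thesis using that c by auto
    qed
  qed
  have "\<exists>r. r \<notin> S \<and> (r, y) \<in> E \<and> (r, u) \<in> E"
  proof -
    from dpath_last[OF t(3), of ?P] show ?thesis
    proof
      assume "\<exists>c\<in>?P - S. dpath E S t c \<and> dpath E ?P c y"
      then obtain c where "c \<in> ?P" "c \<notin> S" "dpath E ?P c y" by blast
      then show ?thesis using dpath_arc[OF pa_treks[OF uV] _ yP] by (auto simp: pa_def)
    next
      assume ty: "dpath E ?P t y"
      show ?thesis
      proof (cases "t \<in> ?P")
        case True
        then show ?thesis using dpath_arc[OF pa_treks[OF uV] True yP ty] t(1) by (auto simp: pa_def)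
      next
        case False
        then have tq: "dpath E S t q" using q by (auto simp: pa_def)
        \<comment> \<open>\<open>c\<close> is the first parent of \<open>u\<close> on the leg
          through \<open>q\<close>; it exists because \<open>q\<close> itself is a parent of
          \<open>u\<close>.\<close>
        obtain c where c: "c \<in> ?P" "c \<notin> S" "dpath E (S \<union> ?P) t c"
          using dpath_first[OF tq, of ?P] q by (auto simp: pa_def)
        have "fork E ?P c y"
          unfolding fork_def using False ty dpath_mono[OF c(3), of ?P] by auto
        then have "(c, y) \<in> E \<or> (y, c) \<in> E"
          using treks_adjacentD[OF pa_treks[OF uV] c(1) yP] c(2) assms(3) by (auto simp: trek_def)
        then show ?thesis
        proof
          \<comment> \<open>Here \<open>c\<close> would be a witness in \<open>U\<close> that is a
            parent of \<open>u\<close>, against the minimality of \<open>u\<close>.\<close>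
          assume "(y, c) \<in> E"
          moreover have "dpath E S c a"
            using u c by (auto simp: U_def pa_def intro: dpath.intros)
          moreover have "fork E S c y"
            unfolding fork_def using t dpath_mono[OF c(3), of S] by auto
          ultimately have "c \<in> U" using c by (auto simp: U_def)
          then show ?thesis using min c(1) by (auto simp: pa_def)
        qed (use c in \<open>auto simp: pa_def\<close>)
      qed
    qed
  qed
  then show ?thesis using u by (auto simp: U_def)
qed

text \<open>Without interfering v-structures, the sets of parents that \<open>b\<close> shares with the apices of the
  two forks are nested, which merges the forks.\<close>

lemma fork_through_source:
  assumes "(b, a) \<in> E" "(b, c) \<in> E" "fork E S a b" "fork E S c b" "b \<in> S"
  shows "fork E S a c"
proof -
  obtain u r where u: "u = a \<or> u \<notin> S \<and> dpath E S u a" "(b, u) \<in> E"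
      "r \<notin> S" "(r, b) \<in> E" "(r, u) \<in> E"
    using fork_apex[OF assms(1,3,5)] by blast
  obtain u' r' where u': "u' = c \<or> u' \<notin> S \<and> dpath E S u' c" "(b, u') \<in> E"
      "r' \<notin> S" "(r', b) \<in> E" "(r', u') \<in> E"
    using fork_apex[OF assms(2,4,5)] by blast
  have "(r, u') \<in> E \<or> (r', u) \<in> E" using pa_nested u u' by blast
  then obtain q where "q \<notin> S" "(q, u) \<in> E" "(q, u') \<in> E" using u u' by blast
  then have "q \<notin> S" "dpath E S q a" "dpath E S q c" using u(1) u'(1) by (auto intro: dpath.intros)
  then show ?thesis by (auto simp: fork_def)
qed

text \<open>Take \<open>u\<close> and \<open>r\<close> from \<open>fork_apex\<close>. Both
  \<open>pa E b \<inter> S\<close> and \<open>pa E b \<inter> pa E u\<close> are initial in the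
  order of \<open>b\<close>, hence nested, and \<open>r\<close> lies in the second but not in the
  first. So every parent of \<open>b\<close> in \<open>S\<close>, in particular \<open>c\<close>, is
  a parent of \<open>u\<close> and reaches \<open>a\<close> outside \<open>S\<close>.\<close>

lemma parent_through_fork:
  assumes S: "good V E ord S" and b: "admissible V E ord b"
    and "(b, a) \<in> E" "fork E S a b" "(c, b) \<in> E" "a \<in> S" "b \<in> S" "c \<in> S"
  shows "(c, a) \<in> E"
proof -
  obtain u r where u: "u = a \<or> u \<notin> S \<and> dpath E S u a" "(b, u) \<in> E"
      "r \<notin> S" "(r, b) \<in> E" "(r, u) \<in> E"
    using fork_apex[OF assms(3,4,7)] by blast
  have "initial E ord b (pa E b \<inter> S)" "initial E ord b (pa E b \<inter> pa E u)"
    using S b assms(7) u(2) by (auto simp: good_def admissible_def)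
  then have "pa E b \<inter> S \<subseteq> pa E b \<inter> pa E u"
    using initial_nested[OF b] u by (fastforce simp: pa_def)
  then have "(c, u) \<in> E" using assms by (auto simp: pa_def)
  then have "dpath E S c a" using u(1) by (auto intro: dpath.intros)
  then show ?thesis using S dpath_arc assms by (auto simp: good_def)
qed

text \<open>Along an active trail from \<open>s\<close>, every collider has a descendant in \<open>Z\<close>, so each node reached is
  linked to \<open>s\<close> by a chain of forks between nodes of \<open>S\<close>. Such a chain (relation \<open>F\<close> below) can be
  rerouted around local sources until it only climbs against the arcs (relation \<open>G\<close>), and then its end
  is a parent of \<open>s\<close>.\<close>

lemma dsep_good:
  assumes S: "good V E ord S" and adm: "\<And>b. b \<in> S \<Longrightarrow> admissible V E ord b"
    and s: "s \<in> S" "\<And>x. x \<in> S \<Longrightarrow> (s, x) \<notin> E\<^sup>+"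
    and Z: "pa E s \<inter> S \<subseteq> Z" "Z \<subseteq> S - {s}"
    and Y: "Y \<subseteq> S - {s} - Z"
  shows "dsep E {s} Y Z"
proof -
  define F where "F = {(a, b). a \<in> S \<and> b \<in> S \<and> fork E S a b}"
  define G where "G = {(a, b). a \<in> S \<and> b \<in> S \<and> (b, a) \<in> E \<and> fork E S a b}"
  have PS: "treks_adjacent E S" using S by (simp add: good_def)
  have G_F: "(s, y') \<in> G\<^sup>*" if "(s, y) \<in> G\<^sup>*" "(y, y') \<in> F" for y y'
    using that
  proof (induction y arbitrary: y' rule: rtrancl_induct)
    case base
    then have F: "s \<in> S" "y' \<in> S" "fork E S s y'" by (auto simp: F_def)
    then have "y' = s \<or> (y', s) \<in> E"
      using treks_adjacentD[OF PS F(1,2)] s(2) by (auto simp: trek_def)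
    then show ?case using F by (auto simp: G_def)
  next
    case (step x y)
    then have F: "y \<in> S" "y' \<in> S" "fork E S y y'" and G: "x \<in> S" "(y, x) \<in> E" "fork E S x y"
      by (auto simp: F_def G_def)
    then consider "y' = y" | "(y', y) \<in> E" | "(y, y') \<in> E"
      using treks_adjacentD[OF PS F(1,2)] by (auto simp: trek_def)
    then show ?case
    proof cases
      case 1
      then show ?thesis using step by auto
    next
      case 2
      then have yy': "(y, y') \<in> G" using F by (auto simp: G_def)
      have "(s, y) \<in> G\<^sup>*" using step.hyps by (rule rtrancl_into_rtrancl)
      then show ?thesis using yy' by (rule rtrancl_into_rtrancl)
    next
      \<comment> \<open>\<open>y\<close> is a common parent of its neighbours \<open>x\<close> and
        \<open>y'\<close> in the chain; it is dropped, and the induction hypothesis at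
        \<open>x\<close> applies to \<open>y'\<close>.\<close>
      case 3
      then have "fork E S x y'"
        using fork_through_source[OF G(2) 3 G(3) fork_sym[OF F(3)]] F by blast
      then have "(x, y') \<in> F" using F G by (auto simp: F_def)
      then show ?thesis using step by blast
    qed
  qed
  have F_G: "(s, y) \<in> G\<^sup>*" if "(s, y) \<in> F\<^sup>*" for y
    using that by (induction rule: rtrancl_induct) (auto intro: G_F)
  have F_S: "y \<in> S" if "(s, y) \<in> F\<^sup>*" for y
    using that s(1) by (cases rule: rtranclE) (auto simp: F_def)
  have G_pa: "(c, s) \<in> E" if "(s, y) \<in> G\<^sup>*" "c \<in> S" "(c, y) \<in> E" for y c
    using that
  proof (induction y rule: rtrancl_induct)
    case (step x y)
    then have "(c, x) \<in> E"
      using parent_through_fork[OF S adm, of y x c] by (auto simp: G_def)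
    then show ?case using step by blast
  qed
  \<comment> \<open>A node of \<open>S\<close> with a path to the chain is a parent of a chain node,
    hence of \<open>s\<close>, and thus lies in \<open>Z\<close>.\<close>
  have up_end: False if "(s, y) \<in> F\<^sup>*" "dpath E S x y" "x \<in> S" "x \<notin> Z" for x y
  proof -
    have "(x, y) \<in> E" using dpath_arc[OF PS] F_S that by blast
    then have "(x, s) \<in> E" using G_pa[OF F_G] that by blast
    then show False using Z(1) that by (auto simp: pa_def)
  qed
  \<comment> \<open>The last link of the rerouted chain makes \<open>x\<close> a parent of the
    preceding node, hence of \<open>s\<close>.\<close>
  have down_end: False if "(s, x) \<in> F\<^sup>*" "x \<noteq> s" "x \<notin> Z" for x
  proof -
    have "(s, x) \<in> G\<^sup>*" using F_G that by blast
    then obtain y where "(s, y) \<in> G\<^sup>*" "(y, x) \<in> G"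
      by (rule rtranclE) (use \<open>x \<noteq> s\<close> in auto)
    then show False using G_pa[of y x] that Z(1) by (auto simp: G_def pa_def)
  qed
  show ?thesis
    unfolding dsep_def
  proof (intro allI impI, elim conjE, rule ccontr)
    fix p assume p: "trail E p" "hd p \<in> {s}" "last p \<in> Y" and act: "\<not> blocked E p Z"
    have ne: "p \<noteq> []" and dist: "distinct p" and adj: "\<And>i. Suc i < length p \<Longrightarrow> adjacent E (p ! i) (p ! Suc i)"
      using p(1) by (auto simp: trail_def successively_conv_nth)
    have p0: "p ! 0 = s" using p(2) ne by (simp add: hd_conv_nth)
    have nz: "p ! i \<notin> Z" if "i < length p" "\<not> converging_at E p i" for i
      using act that by (auto simp: blocked_def)
    have col: "p ! i \<in> Z \<or> (\<exists>z\<in>Z. (p ! i, z) \<in> E\<^sup>+)" if "i < length p" "converging_at E p i" for i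
      using act that by (auto simp: blocked_def de_def)
    have nots: "p ! i \<noteq> s" if "0 < i" "i < length p" for i
      using nth_eq_iff_index_eq[OF dist, of i 0] p0 ne that by auto
    \<comment> \<open>Three states describe how the trail arrives at \<open>p ! i\<close>: against
      an arc, with a directed path to the chain; along an arc, with a fork whose other leg ends in
      the chain; or along an arc, at a descendant of \<open>s\<close>. The end of the chain may be
      \<open>s\<close> itself.\<close>
    define up where "up i \<longleftrightarrow> (p ! i, p ! (i - 1)) \<in> E \<and>
      (\<exists>y. (s, y) \<in> F\<^sup>* \<and> dpath E S (p ! i) y)" for i
    define down where "down i \<longleftrightarrow> (p ! (i - 1), p ! i) \<in> E \<and>
      (\<exists>y t. (s, y) \<in> F\<^sup>* \<and> t \<notin> S \<and> dpath E S t y \<and> dpath E S t (p ! i))" for i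
    define desc where "desc i \<longleftrightarrow> (p ! (i - 1), p ! i) \<in> E \<and> (s, p ! i) \<in> E\<^sup>+" for i
    have downF: "(s, z) \<in> F\<^sup>*" if "(s, y) \<in> F\<^sup>*" "t \<notin> S" "dpath E S t y" "dpath E S t z" "z \<in> S" for y t z
    proof -
      have "y \<in> S" using F_S that(1) .
      moreover have "fork E S y z" using that(2-4) unfolding fork_def by blast
      ultimately have "(y, z) \<in> F" using that(5) by (simp add: F_def)
      with that(1) show ?thesis by (rule rtrancl_into_rtrancl)
    qed
    have state: "up i \<or> down i \<or> desc i" if "0 < i" "i < length p" for i
      using that
    proof (induction i)
      case (Suc i)
      have a: "(p ! i, p ! Suc i) \<in> E \<or> (p ! Suc i, p ! i) \<in> E"
        using adj Suc.prems by (auto simp: adjacent_def)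
      show ?case
      proof (cases "i = 0")
        case True
        then show ?thesis using a p0 by (auto simp: up_def desc_def intro: dpath.arc)
      next
        case False
        then consider "up i" | "down i" | "desc i" using Suc by auto
        then show ?thesis
        proof cases
          case 1
          then have "(p ! (i - 1), p ! i) \<notin> E" using asym by (auto simp: up_def)
          then have "p ! i \<notin> Z" using nz Suc.prems by (auto simp: converging_at_def)
          then have "p ! i \<notin> S" using 1 up_end by (auto simp: up_def)
          then show ?thesis using 1 a by (auto simp: up_def down_def intro: dpath.intros)
        next
          case 2
          then obtain y t where t: "(s, y) \<in> F\<^sup>*" "t \<notin> S" "dpath E S t y" "dpath E S t (p ! i)"
            by (auto simp: down_def)
          have notS: "p ! i \<notin> S" if "p ! i \<notin> Z"
            using down_end[of "p ! i"] downF[OF t] that nots False Suc.prems by auto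
          from a show ?thesis
          proof
            assume d: "(p ! i, p ! Suc i) \<in> E"
            then have "(p ! Suc i, p ! i) \<notin> E" using asym by auto
            then have "p ! i \<notin> Z" using nz Suc.prems by (auto simp: converging_at_def)
            then have "p ! i \<notin> S" by (rule notS)
            then have "dpath E S t (p ! Suc i)"
              by (rule dpath_trans[OF t(4) _ dpath.arc[OF d]])
            then show ?thesis using t d by (auto simp: down_def)
          next
            assume d: "(p ! Suc i, p ! i) \<in> E"
            have "converging_at E p i"
              using 2 d False Suc.prems by (auto simp: converging_at_def down_def)
            show ?thesis
            proof (cases "p ! i \<in> Z")
              case True
              then have "(s, p ! i) \<in> F\<^sup>*" using downF[OF t] Z(2) by auto
              then show ?thesis using d by (auto simp: up_def intro: dpath.arc)
            next
              case False
              then obtain z where z: "z \<in> Z" "(p ! i, z) \<in> E\<^sup>+"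
                using col[OF _ \<open>converging_at E p i\<close>] Suc.prems by auto
              \<comment> \<open>\<open>c\<close> is the first node of \<open>S\<close> on the path
                from the collider to \<open>z\<close>. The open fork prolonged to \<open>c\<close>
                makes \<open>c\<close> the new end of the chain.\<close>
              obtain c where c: "c \<in> S" "dpath E S (p ! i) c"
                using dpath_first[OF trancl_imp_dpath_empty[OF z(2)], of S] z(1) Z(2) by auto
              have "(s, c) \<in> F\<^sup>*"
                using downF[OF t(1-3) _ c(1)] dpath_trans[OF t(4) notS[OF False] c(2)] by blast
              moreover have "dpath E S (p ! Suc i) c"
                using d c notS[OF False] by (auto intro: dpath.step)
              ultimately show ?thesis using d by (auto simp: up_def)
            qed
          qed
        next
          case 3
          from a show ?thesis
          proof
            assume d: "(p ! i, p ! Suc i) \<in> E"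
            then show ?thesis using 3 by (auto simp: desc_def intro: trancl_into_trancl)
          next
            assume d: "(p ! Suc i, p ! i) \<in> E"
            have "converging_at E p i"
              using 3 d False Suc.prems by (auto simp: converging_at_def desc_def)
            \<comment> \<open>An active collider below \<open>s\<close> would give \<open>s\<close>
              a descendant in \<open>Z\<close>, although \<open>s\<close> has none in
              \<open>S\<close>.\<close>
            then obtain z where "z \<in> Z" "(s, z) \<in> E\<^sup>+"
              using col[of i] Suc.prems 3 by (auto simp: desc_def intro: trancl_trans)
            then show ?thesis using s(2) Z(2) by auto
          qed
        qed
      qed
    qed simp
    define n where "n = length p - 1"
    have last: "p ! n \<in> S" "p ! n \<noteq> s" "p ! n \<notin> Z"
      using p(3) ne Y by (auto simp: last_conv_nth n_def)
    then have "n \<noteq> 0" using p0 by (intro notI) auto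
    then have "up n \<or> down n \<or> desc n" using state[of n] ne by (auto simp: n_def)
    then show False
    proof (elim disjE)
      assume "up n"
      then show False using up_end last by (auto simp: up_def)
    next
      assume "down n"
      then have "(s, p ! n) \<in> F\<^sup>*" using downF last(1) by (auto simp: down_def)
      then show False using down_end last by blast
    next
      assume "desc n"
      then show False using s(2) last by (auto simp: desc_def)
    qed
  qed
qed

section \<open>Enlarging good node sets\<close>

lemma good_finite: "good V E ord S \<Longrightarrow> finite S"
  using finite_V by (auto simp: good_def intro: finite_subset)

text \<open>Each \<open>b\<close> in \<open>pa E v\<close> has \<open>v\<close> as a child, so the
  order condition of goodness is the last clause of admissibility at \<open>b\<close>.\<close>

lemma good_pa:
  assumes "v \<in> V" "\<And>b. b \<in> pa E v \<Longrightarrow> admissible V E ord b"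
  shows "good V E ord (pa E v)"
  using assms pa_V pa_treks by (auto simp: good_def admissible_def pa_def)

lemma good_Int_pa:
  assumes "good V E ord S" "w \<in> V" "\<And>b. b \<in> S \<Longrightarrow> admissible V E ord b"
  shows "good V E ord (S \<inter> pa E w)"
  unfolding good_def
proof (intro conjI ballI)
  show "S \<inter> pa E w \<subseteq> V" using assms(1) by (auto simp: good_def)
  show "treks_adjacent E (S \<inter> pa E w)"
    using assms treks_adjacent_Int pa_treks by (auto simp: good_def)
next
  fix b assume b: "b \<in> S \<inter> pa E w"
  have "initial E ord b ((pa E b \<inter> S) \<inter> (pa E b \<inter> pa E w))"
    by (rule initial_Int) (use assms(1,3) b in \<open>auto simp: good_def admissible_def pa_def\<close>)
  moreover have "(pa E b \<inter> S) \<inter> (pa E b \<inter> pa E w) = pa E b \<inter> (S \<inter> pa E w)" by auto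
  ultimately show "initial E ord b (pa E b \<inter> (S \<inter> pa E w))" by simp
qed

lemma wf_ord:
  assumes "admissible V E ord v"
  shows "wf (ord v)" "wf ((ord v)\<inverse>)"
proof -
  have "finite (ord v)"
  proof (rule finite_subset)
    show "ord v \<subseteq> pa E v \<times> pa E v" using assms by (simp add: admissible_def)
    have "finite (pa E v)" using finite_subset[OF pa_V finite_V] .
    then show "finite (pa E v \<times> pa E v)" by simp
  qed
  moreover have "acyclic (ord v)"
    using assms by (auto simp: admissible_def strict_linear_order_on_def acyclic_irrefl trancl_id)
  ultimately show "wf (ord v)" "wf ((ord v)\<inverse>)"
    by (auto intro: finite_acyclic_wf finite_acyclic_wf_converse)
qed

lemma admissibleD:
  assumes "admissible V E ord v"
  shows "(x, y) \<in> ord v \<Longrightarrow> x \<in> pa E v \<and> y \<in> pa E v" "(x, x) \<notin> ord v"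
    "x \<in> pa E v \<Longrightarrow> y \<in> pa E v \<Longrightarrow> x \<noteq> y \<Longrightarrow> (x, y) \<in> ord v \<or> (y, x) \<in> ord v"
    "(x, y) \<in> ord v \<Longrightarrow> (y, z) \<in> ord v \<Longrightarrow> (x, z) \<in> ord v"
    "initial E ord v K \<Longrightarrow> good V E ord K"
    "(v, c) \<in> E \<Longrightarrow> initial E ord v (pa E v \<inter> pa E c)"
  using assms by (auto simp: admissible_def strict_linear_order_on_def irrefl_def total_on_def dest: transD)

lemma initialD: "initial E ord b K \<Longrightarrow> x \<in> K \<Longrightarrow> (y, x) \<in> ord b \<Longrightarrow> y \<in> K"
  by (auto simp: initial_def)

lemma initial_pa_below:
  assumes "admissible V E ord v" "w \<in> pa E v"
  shows "initial E ord v (pa_below E ord v w)" "initial E ord v (insert w (pa_below E ord v w))"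
  using assms(2) admissibleD(1,4)[OF assms(1)] by (auto simp: initial_def pa_below_def)

lemma goodD:
  assumes "good V E ord S"
  shows "S \<subseteq> V" "treks_adjacent E S" "b \<in> S \<Longrightarrow> initial E ord b (pa E b \<inter> S)"
  using assms by (auto simp: good_def)

lemma good_ord_closed:
  assumes "good V E ord S" "b \<in> S" "x \<in> S" "(x, b) \<in> E" "(y, x) \<in> ord b"
  shows "y \<in> S"
  using initialD[OF goodD(3)[OF assms(1,2)], of x y] assms by (auto simp: pa_def)

text \<open>The last interior node in \<open>T\<close> would lie in \<open>T - S\<close> and have an
  arc to \<open>a\<close>.\<close>

lemma dpath_into:
  assumes "treks_adjacent E T" "a \<in> T" "\<And>c. c \<in> T - S \<Longrightarrow> (c, a) \<notin> E" "dpath E S t a"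
  shows "dpath E T t a"
  using dpath_last[OF assms(4), of T] dpath_arc[OF assms(1) _ assms(2)] assms(3) by blast

text \<open>Goodness of \<open>T\<close> already places in \<open>T\<close> every node that precedes
  a parent from \<open>T\<close>. The order conditions therefore only need to be checked against the
  nodes of \<open>T - S\<close>.\<close>

lemma good_insertI:
  assumes S: "good V E ord S" and T: "good V E ord T" and ST: "S \<subseteq> T"
    and adm: "\<And>b. b \<in> T \<Longrightarrow> admissible V E ord b" and w: "w \<in> T - S"
    and 1: "\<And>b y. b \<in> S \<Longrightarrow> (w, b) \<in> E \<Longrightarrow> y \<in> T - S \<Longrightarrow> (y, w) \<notin> ord b"
    and 2: "\<And>x y. x \<in> S \<Longrightarrow> (x, w) \<in> E \<Longrightarrow> y \<in> T - S \<Longrightarrow> (y, x) \<notin> ord w"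
    and 3: "\<And>a. a \<in> S \<Longrightarrow> trek E (insert w S) w a \<Longrightarrow> adjacent E w a"
  shows "good V E ord (insert w S)"
  unfolding good_def
proof (intro conjI ballI)
  show "insert w S \<subseteq> V" using goodD(1)[OF T] w ST by auto
  show "treks_adjacent E (insert w S)"
    unfolding treks_adjacent_def
  proof (intro ballI impI)
    fix a b assume ab: "a \<in> insert w S" "b \<in> insert w S" "a \<noteq> b" and t: "trek E (insert w S) a b"
    have "trek E S a b" using trek_mono[OF t] by auto
    then show "adjacent E a b"
      using ab 3[of a] 3[of b] t trek_sym[OF t] adjacent_sym[of E w a] goodD(2)[OF S]
      by (auto simp: treks_adjacent_def)
  qed
next
  fix b assume b: "b \<in> insert w S"
  show "initial E ord b (pa E b \<inter> insert w S)"
    unfolding initial_def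
  proof (intro conjI ballI allI impI)
    fix x y assume x: "x \<in> pa E b \<inter> insert w S" and yx: "(y, x) \<in> ord b"
    have bT: "b \<in> T" using b w ST by auto
    then have y: "y \<in> pa E b" using admissibleD(1)[OF adm yx] by auto
    have "x \<in> T" using x w ST by auto
    then have yT: "y \<in> T" using good_ord_closed[OF T bT _ _ yx] x by (auto simp: pa_def)
    have "y \<in> S" if "x \<in> S" "b \<in> S"
      using good_ord_closed[OF S that(2,1) _ yx] x by (auto simp: pa_def)
    moreover have "y \<in> S" if "b = w"
    proof -
      have "x \<in> S" using x that no_cycle by (auto simp: pa_def)
      then show ?thesis using 2[of x y] x yx yT that by (auto simp: pa_def)
    qed
    moreover have "y \<in> S" if "b \<in> S" "x = w"
      using 1[of b y] that x yx yT by (auto simp: pa_def)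
    ultimately show "y \<in> pa E b \<inter> insert w S" using y b x by auto
  qed auto
qed

text \<open>If some node of \<open>S\<close> has a parent in \<open>T - S\<close>, take the topologically last such node and add its
  first missing parent; otherwise add a topologically first node of \<open>T - S\<close>.\<close>

lemma good_extend:
  assumes S: "good V E ord S" and T: "good V E ord T" and ST: "S \<subset> T"
    and adm: "\<And>b. b \<in> T \<Longrightarrow> admissible V E ord b"
  shows "\<exists>w\<in>T - S. good V E ord (insert w S)"
proof -
  have "S \<subseteq> T" using ST by auto
  note insertI = good_insertI[OF S T \<open>S \<subseteq> T\<close> adm]
  define A where "A = {b \<in> S. \<exists>w\<in>T - S. (w, b) \<in> E}"
  show ?thesis
  proof (cases "A = {}")
    case False
    then obtain v where v: "v \<in> A" and vmax: "\<And>b. (v, b) \<in> E \<Longrightarrow> b \<notin> A"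
      using wfE_min[OF wf_E_converse, of _ A] by auto
    have vS: "v \<in> S" and vT: "v \<in> T" using v ST by (auto simp: A_def)
    note av = adm[OF vT]
    obtain w0 where "w0 \<in> (T - S) \<inter> pa E v" using v by (auto simp: A_def pa_def)
    then obtain w where w: "w \<in> (T - S) \<inter> pa E v"
        and wmin: "\<And>y. (y, w) \<in> ord v \<Longrightarrow> y \<notin> (T - S) \<inter> pa E v"
      using wfE_min[OF wf_ord(1)[OF av]] by metis
    have wv: "(w, v) \<in> E" "w \<notin> S" "w \<in> T" using w by (auto simp: pa_def)
    define K where "K = pa_below E ord v w"
    have K: "K = pa E v \<inter> S"
    proof (intro set_eqI iffI)
      fix z assume z: "z \<in> K"
      then have "z \<in> T" using good_ord_closed[OF T vT, of w z] wv by (auto simp: K_def pa_below_def)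
      then show "z \<in> pa E v \<inter> S" using z wmin[of z] by (auto simp: K_def pa_below_def)
    next
      fix z assume z: "z \<in> pa E v \<inter> S"
      then have "(w, z) \<notin> ord v" using good_ord_closed[OF S vS, of z w] wv by (auto simp: pa_def)
      then have "(z, w) \<in> ord v" using admissibleD(3)[OF av, of z w] z w by auto
      then show "z \<in> K" using z by (auto simp: K_def pa_below_def)
    qed
    \<comment> \<open>\<open>insert w K\<close> is an initial segment of the order of
      \<open>v\<close>, hence good; conditions on parents of \<open>v\<close> in \<open>S\<close>
      can be read off from it.\<close>
    have Kw: "good V E ord (insert w K)"
      using admissibleD(5)[OF av] initial_pa_below(2)[OF av] w by (auto simp: K_def)
    have "good V E ord (insert w S)"
    proof (rule insertI)
      show "w \<in> T - S" using w by auto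
    next
      fix b y assume b: "b \<in> S" "(w, b) \<in> E" and y: "y \<in> T - S"
      have bT: "b \<in> T" using b ST by auto
      show "(y, w) \<notin> ord b"
      proof
        assume yw: "(y, w) \<in> ord b"
        have ypb: "y \<in> pa E b" using admissibleD(1)[OF adm[OF bT] yw] by auto
        show False
        proof (cases "b = v")
          case True
          then show False using wmin[of y] yw y ypb by auto
        next
          case False
          \<comment> \<open>The fork at \<open>w\<close> makes \<open>b\<close> and \<open>v\<close>
            adjacent, and the maximality of \<open>v\<close> rules out \<open>b\<close> as a child
            of \<open>v\<close>. So \<open>b\<close> is in \<open>K\<close>.\<close>
          have "trek E S b v" using wv b by (auto simp: trek_def fork_def intro: dpath.arc)
          moreover have "b \<in> A" using b wv by (auto simp: A_def)
          ultimately have "(b, v) \<in> E"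
            using treks_adjacentD[OF goodD(2)[OF S] b(1) vS False] vmax by auto
          then have "b \<in> insert w K" using b K by (auto simp: pa_def)
          then have "y \<in> insert w K" using good_ord_closed[OF Kw _ _ b(2) yw] by auto
          then show False using y K yw admissibleD(2)[OF adm[OF bT]] by auto
        qed
      qed
    next
      fix x y assume x: "x \<in> S" "(x, w) \<in> E" and y: "y \<in> T - S"
      show "(y, x) \<notin> ord w"
      proof
        assume yx: "(y, x) \<in> ord w"
        have "dpath E S x v" using x wv by (auto intro: dpath.intros)
        then have "(x, v) \<in> E" using dpath_arc[OF goodD(2)[OF S] x(1) vS] by auto
        then have "x \<in> insert w K" using x K by (auto simp: pa_def)
        then have "y \<in> insert w K" using good_ord_closed[OF Kw _ _ x(2) yx] by auto
        then have "y = w" using y K by auto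
        then show False
          using admissibleD(1)[OF adm[OF wv(3)] yx] no_cycle[of w] by (auto simp: pa_def)
      qed
    next
      fix a assume a: "a \<in> S" and tw: "trek E (insert w S) w a"
      have aT: "a \<in> T" using a ST by auto
      have t: "trek E S w a" using trek_mono[OF tw] by auto
      show "adjacent E w a"
      proof (cases "a = v")
        case False
        have "trek E S v a"
        proof -
          have "dpath E S w v" using wv by (auto intro: dpath.arc)
          then show ?thesis using t wv(2) dpath_trans[of E S _ w v]
            by (auto simp: trek_def fork_def)
        qed
        then consider "(a, v) \<in> E" | "(v, a) \<in> E"
          using treks_adjacentD[OF goodD(2)[OF S] vS a] False by auto
        then show ?thesis
        proof cases
          case 1
          then have "a \<in> insert w K" "a \<noteq> w" using a K wv by (auto simp: pa_def)
          moreover have "trek E (insert w K) w a"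
            by (rule trek_mono[OF tw]) (use K in auto)
          ultimately show ?thesis using goodD(2)[OF Kw] by (auto simp: treks_adjacent_def)
        next
          case 2
          \<comment> \<open>The aim is a contradiction. By the maximality of \<open>v\<close>, its
            child \<open>a\<close> has no parents in \<open>T - S\<close>, so paths into
            \<open>a\<close> that avoid \<open>S\<close> avoid \<open>T\<close> too.\<close>
          then have noarc: "\<And>c. c \<in> T - S \<Longrightarrow> (c, a) \<notin> E" using vmax a by (auto simp: A_def)
          have into: "dpath E T x a" if "dpath E S x a" for x
            using dpath_into[OF goodD(2)[OF T] aT noarc that] .
          have outside: "x \<notin> T" if "dpath E S x a" "x \<notin> S" for x
            using into[OF that(1)] dpath_arc[OF goodD(2)[OF T] _ aT] noarc that(2) by auto
          have noback: "(a, w) \<notin> E\<^sup>+"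
            using 2 wv(1) no_cycle[of a] trancl_into_trancl[of a w E v]
              trancl_into_trancl[of a v E a] by auto
          have False
          proof -
            consider "dpath E S w a" | "dpath E S a w" | "fork E S w a"
              using t by (auto simp: trek_def)
            then show False
            proof cases
              case 1
              then show False using outside wv by auto
            next
              case 2
              then show False using dpath_trancl[OF 2] noback by auto
            next
              case 3
              then obtain u where u: "u \<notin> S" "dpath E S u w" "dpath E S u a"
                by (auto simp: fork_def)
              have uT: "u \<notin> T" using outside u by auto
              have "S \<union> T = T" using ST by auto
              \<comment> \<open>\<open>z\<close> is the first node of \<open>T\<close> on the leg to
                \<open>w\<close>. It is adjacent to \<open>a\<close>, necessarily as a child, and a
                cycle from \<open>a\<close> through \<open>z\<close>, \<open>w\<close> and
                \<open>v\<close> back to \<open>a\<close> results.\<close>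
              then obtain z where z: "z \<in> T - S" "dpath E T u z" "z = w \<or> dpath E S z w"
                using dpath_first[OF u(2), of T] wv by auto
              have "trek E T z a" using uT z into[OF u(3)] by (auto simp: trek_def fork_def)
              moreover have "z \<noteq> a" using z a by auto
              ultimately have "(a, z) \<in> E"
                using treks_adjacentD[OF goodD(2)[OF T] _ aT, of z] noarc z by auto
              then have "(a, w) \<in> E\<^sup>+"
                using z(3) dpath_trancl[of E S z w] by (auto intro: trancl_into_trancl2)
              then show False using noback by simp
            qed
          qed
          then show ?thesis ..
        qed
      qed (use wv in \<open>auto simp: adjacent_def\<close>)
    qed
    then show ?thesis using w by auto
  next
    \<comment> \<open>Neither the nodes of \<open>S\<close> nor the minimal node \<open>w\<close>
      have parents in \<open>T - S\<close>; hence treks from \<open>w\<close> into \<open>S\<close>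
      that avoid \<open>S\<close> avoid all of \<open>T\<close>.\<close>
    case True
    then have noarc: "\<And>a c. a \<in> S \<Longrightarrow> c \<in> T - S \<Longrightarrow> (c, a) \<notin> E" by (auto simp: A_def)
    obtain w0 where "w0 \<in> T - S" using ST by auto
    then obtain w where w: "w \<in> T - S" and wmin: "\<And>y. (y, w) \<in> E \<Longrightarrow> y \<notin> T - S"
      using wfE_min[OF wf_E] by metis
    have wT: "w \<in> T" using w by auto
    have "good V E ord (insert w S)"
    proof (rule insertI[OF _ w])
      fix x y assume "y \<in> T - S"
      then show "(y, x) \<notin> ord w"
        using admissibleD(1)[OF adm[OF wT], of y x] wmin[of y] by (auto simp: pa_def)
    next
      fix a assume a: "a \<in> S" and tw: "trek E (insert w S) w a"
      have aT: "a \<in> T" using a ST by auto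
      have into: "dpath E T x a" if "dpath E S x a" for x
        using dpath_into[OF goodD(2)[OF T] aT noarc[OF a] that] .
      have outside: "x \<notin> T" if "dpath E S x a" "x \<notin> S" for x
        using into[OF that(1)] dpath_arc[OF goodD(2)[OF T] _ aT] noarc[OF a] that(2) by auto
      have into': "dpath E T x w" if "dpath E S x w" for x
        using dpath_into[OF goodD(2)[OF T] wT _ that] wmin by auto
      have "trek E S w a" using trek_mono[OF tw] by auto
      then have "trek E T w a"
        using into into' outside unfolding trek_def fork_def by blast
      then show "adjacent E w a"
        using goodD(2)[OF T] wT aT a w by (auto simp: treks_adjacent_def)
    qed (use adm noarc w in auto)
    then show ?thesis using w by auto
  qed
qed

end

section \<open>Existence of parental orders\<close>

definition list_order :: "'a list \<Rightarrow> 'a rel" where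
  "list_order ws = {(ws ! i, ws ! j) | i j. i < j \<and> j < length ws}"

lemma strict_linear_list_order:
  assumes "distinct ws"
  shows "list_order ws \<subseteq> set ws \<times> set ws" "strict_linear_order_on (set ws) (list_order ws)"
proof -
  show "list_order ws \<subseteq> set ws \<times> set ws" by (auto simp: list_order_def)
  have "trans (list_order ws)"
  proof (rule transI)
    fix x y z assume "(x, y) \<in> list_order ws" "(y, z) \<in> list_order ws"
    then obtain i j k l where ij: "x = ws ! i" "y = ws ! j" "i < j" "j < length ws"
        and kl: "y = ws ! k" "z = ws ! l" "k < l" "l < length ws"
      by (auto simp: list_order_def)
    then have "j = k" using nth_eq_iff_index_eq[OF assms, of j k] by simp
    then have "i < l" using ij kl by simp
    then show "(x, z) \<in> list_order ws" using ij(1) kl(2,4) by (auto simp: list_order_def)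
  qed
  moreover have "irrefl (list_order ws)"
    using nth_eq_iff_index_eq[OF assms] by (fastforce simp: irrefl_def list_order_def)
  moreover have "total_on (set ws) (list_order ws)"
  proof (rule total_onI)
    fix x y assume "x \<in> set ws" "y \<in> set ws" "x \<noteq> y"
    then obtain i j where "x = ws ! i" "y = ws ! j" "i < length ws" "j < length ws" "i \<noteq> j"
      by (auto simp: in_set_conv_nth)
    then show "(x, y) \<in> list_order ws \<or> (y, x) \<in> list_order ws"
      by (cases "i < j") (auto simp: list_order_def)
  qed
  ultimately show "strict_linear_order_on (set ws) (list_order ws)"
    by (simp add: strict_linear_order_on_def)
qed

lemma list_order_initial_take:
  assumes "distinct ws" "(y, x) \<in> list_order ws" "x \<in> set (take n ws)"
  shows "y \<in> set (take n ws)"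
proof -
  obtain i j where ij: "y = ws ! i" "x = ws ! j" "i < j" "j < length ws"
    using assms(2) by (auto simp: list_order_def)
  obtain k where k: "x = ws ! k" "k < n" "k < length ws"
    using assms(3) by (auto simp: in_set_conv_nth)
  then have "j = k" using ij nth_eq_iff_index_eq[OF assms(1), of j k] by simp
  then show ?thesis using ij k by (auto simp: in_set_conv_nth intro!: exI[of _ i])
qed

lemma list_order_initial_is_take:
  assumes "K \<subseteq> set ws" "\<And>x y. x \<in> K \<Longrightarrow> (y, x) \<in> list_order ws \<Longrightarrow> y \<in> K"
  shows "\<exists>n. K = set (take n ws)"
proof -
  \<comment> \<open>The first position whose entry is outside \<open>K\<close>, or
    \<open>length ws\<close> if there is none.\<close>
  define n where "n = (LEAST n. n = length ws \<or> ws ! n \<notin> K)"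
  have n: "n = length ws \<or> ws ! n \<notin> K"
    unfolding n_def by (rule LeastI[of _ "length ws"]) simp
  have below: "i \<noteq> length ws \<and> ws ! i \<in> K" if "i < n" for i
    using not_less_Least[of i "\<lambda>n. n = length ws \<or> ws ! n \<notin> K"] that unfolding n_def by blast
  have "n \<le> length ws" unfolding n_def by (rule Least_le) simp
  have "K = set (take n ws)"
  proof (intro set_eqI iffI)
    fix x assume x: "x \<in> K"
    then have "x \<in> set ws" using assms(1) by blast
    then obtain i where i: "x = ws ! i" "i < length ws" by (auto simp: in_set_conv_nth)
    have "i < n"
    proof (rule ccontr)
      assume "\<not> i < n"
      then have "n < i \<or> n = i" "n < length ws" using i by auto
      then have "ws ! n \<in> K" using assms(2)[OF x, of "ws ! n"] i x by (auto simp: list_order_def)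
      then show False using n \<open>n < length ws\<close> by simp
    qed
    then show "x \<in> set (take n ws)" using i by (auto simp: in_set_conv_nth intro!: exI[of _ i])
  qed (use below in \<open>auto simp: in_set_conv_nth\<close>)
  then show ?thesis by blast
qed

section \<open>Enumerations with good prefixes, and the choice of orders\<close>

context integrable_dag
begin

text \<open>\<open>good_extend\<close> is iterated. The given list stays a prefix, so that sets
  realised as its prefixes are kept.\<close>

lemma good_refine:
  assumes "good V E ord T" "\<And>b. b \<in> T \<Longrightarrow> admissible V E ord b"
    and "distinct us" "set us \<subseteq> T" "\<And>n. good V E ord (set (take n us))"
  shows "\<exists>ws. distinct (us @ ws) \<and> set (us @ ws) = T \<and>
           (\<forall>n. good V E ord (set (take n (us @ ws))))"
  using assms(3-5)
proof (induction "card (T - set us)" arbitrary: us rule: less_induct)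
  case less
  show ?case
  proof (cases "set us = T")
    case True
    then show ?thesis using less.prems by (intro exI[of _ "[]"]) auto
  next
    case False
    have us: "good V E ord (set us)" using less.prems(3)[of "length us"] by simp
    obtain w where w: "w \<in> T - set us" "good V E ord (insert w (set us))"
      using good_extend[OF us assms(1) _ assms(2)] less.prems False by auto
    have "card (T - set (us @ [w])) < card (T - set us)"
      using w good_finite[OF assms(1)] by (intro psubset_card_mono) auto
    moreover have "good V E ord (set (take n (us @ [w])))" for n
      using less.prems(3)[of n] w(2) by (cases "n \<le> length us") auto
    ultimately obtain ws where "distinct ((us @ [w]) @ ws)" "set ((us @ [w]) @ ws) = T"
        "\<forall>n. good V E ord (set (take n ((us @ [w]) @ ws)))"
      using less.hyps[of "us @ [w]"] less.prems w(1) by auto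
    then show ?thesis by (intro exI[of _ "w # ws"]) auto
  qed
qed

text \<open>The sets are added by increasing cardinality, so each new \<open>B\<close> contains all
  previous ones and the list built so far is refined to an enumeration of \<open>B\<close>.\<close>

lemma good_chain_list:
  assumes "finite \<B>" "\<And>B. B \<in> \<B> \<Longrightarrow> good V E ord B"
    and "\<And>B b. B \<in> \<B> \<Longrightarrow> b \<in> B \<Longrightarrow> admissible V E ord b"
    and "\<And>A B. A \<in> \<B> \<Longrightarrow> B \<in> \<B> \<Longrightarrow> A \<subseteq> B \<or> B \<subseteq> A"
  shows "\<exists>ws. distinct ws \<and> set ws = \<Union>\<B> \<and> (\<forall>n. good V E ord (set (take n ws))) \<and>
           (\<forall>B\<in>\<B>. \<exists>n. B = set (take n ws))"
  using assms
proof (induction \<B> rule: finite_ranking_induct[where f = card])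
  case empty
  show ?case by (intro exI[of _ "[]"]) (auto simp: good_def treks_adjacent_def)
next
  case (insert B \<B>)
  obtain us where us: "distinct us" "set us = \<Union>\<B>" "\<And>n. good V E ord (set (take n us))"
      "\<forall>A\<in>\<B>. \<exists>n. A = set (take n us)"
  proof -
    have "\<exists>us. distinct us \<and> set us = \<Union>\<B> \<and> (\<forall>n. good V E ord (set (take n us))) \<and>
        (\<forall>A\<in>\<B>. \<exists>n. A = set (take n us))"
    proof (rule insert.IH)
      show "good V E ord A" if "A \<in> \<B>" for A using insert.prems(1)[of A] that by simp
      show "admissible V E ord b" if "A \<in> \<B>" "b \<in> A" for A b
        using insert.prems(2)[of A b] that by simp
      show "A \<subseteq> A' \<or> A' \<subseteq> A" if "A \<in> \<B>" "A' \<in> \<B>" for A A'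
        using insert.prems(3)[of A A'] that by simp
    qed
    then show ?thesis using that by blast
  qed
  have gB: "good V E ord B" using insert.prems(1)[of B] by simp
  have "A \<subseteq> B" if "A \<in> \<B>" for A
  proof -
    have "A \<subseteq> B \<or> B \<subseteq> A" using insert.prems(3)[of A B] that by auto
    moreover have "finite A" using good_finite[of ord A] insert.prems(1)[of A] that by simp
    ultimately show ?thesis using insert.hyps(2)[OF that] card_seteq[of A B] by auto
  qed
  then have usB: "set us \<subseteq> B" using us by blast
  have "admissible V E ord b" if "b \<in> B" for b
    using insert.prems(2)[of B b] that by simp
  with usB obtain ws where ws: "distinct (us @ ws)" "set (us @ ws) = B"
      "\<forall>n. good V E ord (set (take n (us @ ws)))"
    using good_refine[OF gB _ us(1) _ us(3)] by blast
  have "\<exists>n. A = set (take n (us @ ws))" if A: "A \<in> \<B>" for A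
  proof -
    obtain n where "A = set (take n us)" using us(4) A by auto
    then have "A = set (take (min n (length us)) (us @ ws))" by (simp add: min_def)
    then show ?thesis by blast
  qed
  moreover have "B = set (take (length (us @ ws)) (us @ ws))" using ws by simp
  moreover have "set (us @ ws) = \<Union>(insert B \<B>)" using usB us(2) ws(2) by auto
  ultimately have "\<forall>A\<in>insert B \<B>. \<exists>n. A = set (take n (us @ ws))"
      "set (us @ ws) = \<Union>(insert B \<B>)"
    by blast+
  then show ?case using ws(1,3) by (intro exI[of _ "us @ ws"] conjI)
qed

lemma good_cong:
  assumes "\<And>b. b \<in> K \<Longrightarrow> ord b = ord' b"
  shows "good V E ord K \<longleftrightarrow> good V E ord' K"
  using assms by (auto simp: good_def initial_def)

lemma initial_cong: "ord b = ord' b \<Longrightarrow> initial E ord b K \<longleftrightarrow> initial E ord' b K"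
  by (simp add: initial_def)

text \<open>The sets \<open>pa E v \<inter> pa E c\<close> form a chain by \<open>pa_nested\<close>
  and are good. The initial segments of the order given by a list are its prefixes, so an
  enumeration from \<open>good_chain_list\<close> is as required.\<close>

lemma exists_admissible_order:
  assumes v: "v \<in> V" and adm: "\<And>b. b \<in> pa E v \<Longrightarrow> admissible V E ord b"
  shows "\<exists>r. admissible V E (ord(v := r)) v"
proof -
  \<comment> \<open>\<open>pa E v\<close> itself is included so that the list enumerates all
    parents.\<close>
  define \<B> where "\<B> = insert (pa E v) ((\<lambda>c. pa E v \<inter> pa E c) ` {c. (v, c) \<in> E})"
  have gpa: "good V E ord (pa E v)" by (rule good_pa[OF v adm])
  have "{c. (v, c) \<in> E} \<subseteq> V" using E_sub by auto
  then have "finite \<B>" using finite_subset[OF _ finite_V] by (simp add: \<B>_def)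
  moreover have "good V E ord B" if "B \<in> \<B>" for B
    using that gpa good_Int_pa[OF gpa _ adm] E_sub by (auto simp: \<B>_def)
  moreover have "admissible V E ord b" if "B \<in> \<B>" "b \<in> B" for B b
    using that adm by (auto simp: \<B>_def)
  moreover have "A \<subseteq> B \<or> B \<subseteq> A" if AB: "A \<in> \<B>" "B \<in> \<B>" for A B
  proof (rule ccontr)
    assume n: "\<not> ?thesis"
    have "A \<subseteq> pa E v" "B \<subseteq> pa E v" using that by (auto simp: \<B>_def)
    then have "A \<noteq> pa E v" "B \<noteq> pa E v" using n by blast+
    then obtain a b where ab: "A = pa E v \<inter> pa E a" "(v, a) \<in> E"
        "B = pa E v \<inter> pa E b" "(v, b) \<in> E"
      using AB unfolding \<B>_def by blast
    obtain x y where "x \<in> A" "x \<notin> B" "y \<in> B" "y \<notin> A" using n by blast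
    then show False using ab pa_nested[of v a b x y] by (simp add: pa_def)
  qed
  ultimately obtain ws where ws: "distinct ws" "set ws = \<Union>\<B>"
      "\<forall>n. good V E ord (set (take n ws))" "\<forall>B\<in>\<B>. \<exists>n. B = set (take n ws)"
    using good_chain_list[of \<B> ord] by blast
  have set_ws: "set ws = pa E v" using ws(2) by (auto simp: \<B>_def)
  let ?ord = "ord(v := list_order ws)"
  have "good V E ?ord K" if K: "initial E ?ord v K" for K
  proof -
    have "\<exists>n. K = set (take n ws)"
      by (rule list_order_initial_is_take) (use K set_ws in \<open>auto simp: initial_def\<close>)
    then have "good V E ord K" using ws(3) by auto
    moreover have "v \<notin> K" using K no_cycle[of v] by (auto simp: initial_def pa_def)
    then have "good V E ord K \<longleftrightarrow> good V E ?ord K" by (intro good_cong) auto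
    ultimately show ?thesis by simp
  qed
  moreover have "initial E ?ord v (pa E v \<inter> pa E c)" if "(v, c) \<in> E" for c
  proof -
    have "pa E v \<inter> pa E c \<in> \<B>" using that by (auto simp: \<B>_def)
    then obtain n where n: "pa E v \<inter> pa E c = set (take n ws)" using ws(4) by blast
    show ?thesis
      unfolding initial_def n
    proof (intro conjI ballI allI impI)
      show "set (take n ws) \<subseteq> pa E v" using n by blast
      fix x y assume "x \<in> set (take n ws)" "(y, x) \<in> ?ord v"
      then show "y \<in> set (take n ws)" using list_order_initial_take[OF ws(1)] by simp
    qed
  qed
  ultimately have "admissible V E ?ord v"
    using strict_linear_list_order[OF ws(1)] unfolding admissible_def set_ws by simp
  then show ?thesis by blast
qed

lemma admissible_upd:
  assumes "admissible V E ord u" "v \<notin> pa E u" "v \<noteq> u"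
  shows "admissible V E (ord(v := r)) u"
proof -
  have i: "initial E (ord(v := r)) u K \<longleftrightarrow> initial E ord u K" for K
    by (rule initial_cong) (use assms(3) in simp)
  have "good V E (ord(v := r)) K" if K: "initial E ord u K" for K
  proof -
    have "v \<notin> K" using K assms(2) by (auto simp: initial_def)
    then have "good V E (ord(v := r)) K \<longleftrightarrow> good V E ord K"
      by (intro good_cong) auto
    then show ?thesis using admissibleD(5)[OF assms(1) K] by simp
  qed
  moreover have "(ord(v := r)) u = ord u" using assms(3) by simp
  ultimately show ?thesis
    using assms(1) unfolding admissible_def i by metis
qed

text \<open>The orders are fixed along a growing set \<open>U\<close> closed under parents. Changing
  the order at a new node \<open>v\<close> outside \<open>U\<close> does not affect
  \<open>U\<close>, since \<open>v\<close> is no parent of a node there.\<close>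

lemma exists_admissible_orders: "\<exists>ord. \<forall>v\<in>V. admissible V E ord v"
proof -
  have "\<exists>U ord. U \<subseteq> V \<and> card U = n \<and> (\<forall>u\<in>U. pa E u \<subseteq> U \<and> admissible V E ord u)"
    if "n \<le> card V" for n
    using that
  proof (induction n)
    case 0
    show ?case by (rule exI[of _ "{}"]) simp
  next
    case (Suc n)
    then obtain U ord where U: "U \<subseteq> V" "card U = n"
        and pa_adm: "\<forall>u\<in>U. pa E u \<subseteq> U \<and> admissible V E ord u"
      by auto
    have paU: "pa E u \<subseteq> U" and adm: "admissible V E ord u" if "u \<in> U" for u
      using pa_adm that by auto
    have "U \<noteq> V" using U Suc.prems by auto
    then obtain v0 where "v0 \<in> V - U" using U by auto
    then obtain v where v: "v \<in> V - U" "\<And>y. (y, v) \<in> E \<Longrightarrow> y \<notin> V - U"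
      using wfE_min[OF wf_E] by metis
    then have pav: "pa E v \<subseteq> U" using pa_V by (auto simp: pa_def)
    then obtain r where r: "admissible V E (ord(v := r)) v"
      using exists_admissible_order[of v ord] adm v(1) by auto
    have "admissible V E (ord(v := r)) u" if "u \<in> U" for u
      using admissible_upd[OF adm[OF that]] paU[OF that] that v(1) by auto
    then have "\<forall>u\<in>insert v U. pa E u \<subseteq> insert v U \<and> admissible V E (ord(v := r)) u"
      using r pav paU by auto
    moreover have "card (insert v U) = Suc n"
      using U v(1) finite_subset[OF U(1) finite_V] by simp
    moreover have "insert v U \<subseteq> V" using U(1) v(1) by auto
    ultimately show ?case
      by (intro exI[of _ "insert v U"] exI[of _ "ord(v := r)"] conjI)
  qed
  from this[of "card V"] obtain U ord where "U \<subseteq> V" "card U = card V" "\<forall>u\<in>U. admissible V E ord u"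
    by auto
  moreover then have "U = V" using card_subset_eq[OF finite_V] by auto
  ultimately show ?thesis by blast
qed

end

section \<open>Recursions without integration\<close>

abbreviation computable :: "'a set \<Rightarrow> 'a rel \<Rightarrow> ('a \<Rightarrow> 'a rel) \<Rightarrow> 'a \<Rightarrow> 'a set \<Rightarrow> bool" where
  "computable V E ord v K \<equiv> \<not> margin_requires_integration V E ord (Margin v K)"

lemma computable_empty: "computable V E ord v {}"
proof -
  have "is_recursion v {} (Unconditional (Margin v {}))" by (rule is_recursion.intros)
  then show ?thesis
    by (auto simp: recursions_def proper_def intro!: exI[of _ "Unconditional (Margin v {})"])
qed

lemma computable_step:
  assumes "k \<in> K" "specified V E ord (Copula (Upair v k) (K - {k}))"
    and "computable V E ord v (K - {k})" "computable V E ord k (K - {k})"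
  shows "computable V E ord v K"
proof -
  obtain Rv Rk where R: "is_recursion v (K - {k}) Rv" "proper V E ord Rv"
      "is_recursion k (K - {k}) Rk" "proper V E ord Rk"
    using assms(3,4) by (auto simp: recursions_def)
  let ?R = "Step (Margin v K) k (Copula (Upair v k) (K - {k})) Rv Rk"
  have "is_recursion v K ?R" by (rule is_recursion.intros(2)[OF assms(1) R(1,3)])
  moreover have "proper V E ord ?R" using R assms(2) by (auto simp: proper_def)
  ultimately show ?thesis by (auto simp: recursions_def)
qed

section \<open>Proper recursions within good sets\<close>

context integrable_dag
begin

text \<open>A node without descendants in \<open>S\<close> is neither an interior node of a directed
  path into \<open>S\<close> nor the apex of a fork between nodes of \<open>S\<close>. Removing it
  thus frees no trek.\<close>

lemma good_remove_sink:
  assumes S: "good V E ord S" and k: "k \<in> S" "\<And>x. x \<in> S \<Longrightarrow> (k, x) \<notin> E\<^sup>+"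
  shows "good V E ord (S - {k})"
proof -
  have dp: "dpath E S x y" if "dpath E (S - {k}) x y" "y \<in> S" for x y
  proof -
    have "S - {k} \<union> {k} = S" using k by auto
    then show ?thesis
      using dpath_first[OF that(1), of "{k}"] dpath_trancl[of E "S - {k}" k y] k(2)[OF that(2)] by auto
  qed
  have "treks_adjacent E (S - {k})"
    unfolding treks_adjacent_def
  proof (intro ballI impI)
    fix a b assume ab: "a \<in> S - {k}" "b \<in> S - {k}" "a \<noteq> b" and t: "trek E (S - {k}) a b"
    have "trek E S a b"
    proof -
      consider "dpath E (S - {k}) a b" | "dpath E (S - {k}) b a" | "fork E (S - {k}) a b"
        using t by (auto simp: trek_def)
      then show ?thesis
      proof cases
        case 3
        then obtain u where u: "u \<notin> S - {k}" "dpath E (S - {k}) u a" "dpath E (S - {k}) u b"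
          by (auto simp: fork_def)
        then have "u \<notin> S" using dpath_trancl[OF u(2)] k(2)[of a] ab by auto
        then show ?thesis using dp u ab by (auto simp: trek_def fork_def)
      qed (use dp ab in \<open>auto simp: trek_def\<close>)
    qed
    then show "adjacent E a b" using goodD(2)[OF S] ab by (auto simp: treks_adjacent_def)
  qed
  moreover have "initial E ord b (pa E b \<inter> (S - {k}))" if "b \<in> S - {k}" for b
  proof -
    have "pa E b \<inter> (S - {k}) = pa E b \<inter> S" using k(2)[of b] that by (auto simp: pa_def)
    then show ?thesis using goodD(3)[OF S, of b] that by auto
  qed
  ultimately show ?thesis using goodD(1)[OF S] by (auto simp: good_def)
qed

text \<open>The node \<open>k\<close> is the one added last when \<open>S\<close> is enlarged step
  by step to \<open>T\<close>.\<close>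

lemma good_predecessor:
  assumes "good V E ord S" "good V E ord T" "S \<subset> T"
    and "\<And>b. b \<in> T \<Longrightarrow> admissible V E ord b"
  shows "\<exists>k\<in>T - S. good V E ord (T - {k})"
  using assms(1,3)
proof (induction "card (T - S)" arbitrary: S rule: less_induct)
  case less
  obtain w where w: "w \<in> T - S" "good V E ord (insert w S)"
    using good_extend[OF less.prems(1) assms(2) less.prems(2) assms(4)] by blast
  show ?case
  proof (cases "insert w S = T")
    case True
    then have "T - {w} = S" using w by auto
    then show ?thesis using w less.prems(1) by auto
  next
    case False
    have "card (T - insert w S) < card (T - S)"
      using w good_finite[OF assms(2)] by (intro psubset_card_mono) auto
    moreover have "insert w S \<subset> T" using w less.prems False by auto
    ultimately obtain k where "k \<in> T - insert w S" "good V E ord (T - {k})"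
      using less.hyps[of "insert w S"] w(2) by blast
    then show ?thesis by auto
  qed
qed

lemma specified_dsep:
  assumes S: "good V E ord S" and adm: "\<And>b. b \<in> S \<Longrightarrow> admissible V E ord b"
    and s: "s \<in> S" "\<And>x. x \<in> S \<Longrightarrow> (s, x) \<notin> E\<^sup>+"
    and k: "k \<in> S" "k \<noteq> s" "(k, s) \<notin> E"
  shows "specified V E ord (Copula (Upair s k) (S - {s, k}))"
proof -
  have "(s, s) \<notin> E" using no_cycle[of s] by auto
  then have "dsep E {s} {k} (S - {s, k})"
    by (intro dsep_good[OF S adm s]) (use k in \<open>auto simp: pa_def\<close>)
  moreover have "s \<in> V" "k \<in> V" "S - {s, k} \<subseteq> V - {s, k}" using s(1) k goodD(1)[OF S] by auto
  ultimately show ?thesis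
    unfolding specified_def using k(2) by blast
qed

text \<open>\<open>J\<close> collects the non-parents of \<open>s\<close>. If it is empty, clause
  (i) applies; otherwise clause (iii) does, because the parents of \<open>s\<close> in
  \<open>S\<close> separate \<open>s\<close> from \<open>J\<close>.\<close>

lemma specified_arc:
  assumes S: "good V E ord S" and adm: "\<And>b. b \<in> S \<Longrightarrow> admissible V E ord b"
    and s: "s \<in> S" "\<And>x. x \<in> S \<Longrightarrow> (s, x) \<notin> E\<^sup>+"
    and w: "w \<in> S" "(w, s) \<in> E" and below: "pa E s \<inter> S - {w} = pa_below E ord s w"
  shows "specified V E ord (Copula (Upair w s) (S - {s, w}))"
proof -
  define J where "J = S - {s} - pa E s"
  have "s \<notin> pa E s" using no_cycle[of s] by (auto simp: pa_def)
  have "w \<noteq> s" using w no_cycle[of s] by auto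
  have eq: "S - {s, w} = pa_below E ord s w \<union> J"
    unfolding J_def below[symmetric] using w \<open>s \<notin> pa E s\<close> by (auto simp: pa_def)
  have disj: "pa_below E ord s w \<inter> J = {}" by (auto simp: J_def pa_below_def)
  have "insert w (pa_below E ord s w) = pa E s \<inter> S"
    unfolding below[symmetric] using w by (auto simp: pa_def)
  moreover have "dsep E {s} J (pa E s \<inter> S)"
    by (rule dsep_good[OF S adm s]) (use \<open>s \<notin> pa E s\<close> in \<open>auto simp: J_def\<close>)
  ultimately have "dsep E {s} J (pa_below E ord s w \<union> {w})" by simp
  then have "S - {s, w} = pa_below E ord s w \<or>
      (\<exists>J. S - {s, w} = pa_below E ord s w \<union> J \<and> pa_below E ord s w \<inter> J = {} \<and>
        J \<noteq> {} \<and> dsep E {s} J (pa_below E ord s w \<union> {w}))"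
    using eq disj by (cases "J = {}") (simp, blast)
  moreover have "w \<in> V" "s \<in> V" "S - {s, w} \<subseteq> V - {w, s}" using s(1) w goodD(1)[OF S] by auto
  ultimately show ?thesis
    unfolding specified_def using w(2) \<open>w \<noteq> s\<close> by blast
qed

lemma pa_below_last:
  assumes "admissible V E ord s" "initial E ord s P" "initial E ord s (P - {w})" "w \<in> P"
  shows "P - {w} = pa_below E ord s w"
proof (intro set_eqI iffI)
  have sub: "P \<subseteq> pa E s" using assms(2) by (simp add: initial_def)
  fix x
  assume x: "x \<in> P - {w}"
  then have "(w, x) \<notin> ord s" using initialD[OF assms(3) x, of w] by auto
  then have "(x, w) \<in> ord s" using admissibleD(3)[OF assms(1), of x w] x assms(4) sub by auto
  then show "x \<in> pa_below E ord s w" using x sub by (auto simp: pa_below_def)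
next
  fix x assume "x \<in> pa_below E ord s w"
  then have "(x, w) \<in> ord s" by (auto simp: pa_below_def)
  then show "x \<in> P - {w}"
    using initialD[OF assms(2,4)] admissibleD(2)[OF assms(1), of x] by auto
qed

text \<open>It suffices to find \<open>k\<close> such that the copula of \<open>w\<close> and
  \<open>k\<close> given the rest of \<open>S\<close> is specified and both \<open>S - {k}\<close>
  and \<open>S - {w, k}\<close> are good. A node other than \<open>w\<close> without descendants in
  \<open>S\<close> will do. If there is none, \<open>k\<close> is a suitable non-parent of
  \<open>w\<close>, or the last parent when all other nodes are parents.\<close>

lemma computable_good:
  assumes adm: "\<And>v. v \<in> V \<Longrightarrow> admissible V E ord v"
    and "good V E ord S" "w \<in> S" "good V E ord (S - {w})"
  shows "computable V E ord w (S - {w})"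
  using assms(2-)
proof (induction "card S" arbitrary: S w rule: less_induct)
  case less
  note S = less.prems(1) and wS = less.prems(2) and Sw = less.prems(3)
  have admS: "\<And>b. b \<in> S \<Longrightarrow> admissible V E ord b" using adm goodD(1)[OF S] by auto
  have finS: "finite S" using good_finite[OF S] .
  \<comment> \<open>The two margins of the recursion step belong to the smaller sets
    \<open>S - {k}\<close> with node \<open>w\<close> and \<open>S - {w}\<close> with node
    \<open>k\<close>.\<close>
  have reduce: ?case
    if k: "k \<in> S" "k \<noteq> w" and spec: "specified V E ord (Copula (Upair w k) (S - {w, k}))"
      and gk: "good V E ord (S - {k})" and gwk: "good V E ord (S - {w, k})" for k
  proof (rule computable_step)
    have eq: "S - {w} - {k} = S - {w, k}" "S - {k} - {w} = S - {w, k}" by auto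
    have "card (S - {k}) < card S" "card (S - {w}) < card S"
      using card_Diff1_less[OF finS k(1)] card_Diff1_less[OF finS wS] .
    then have "computable V E ord w (S - {k} - {w})" "computable V E ord k (S - {w} - {k})"
      using less.hyps[of "S - {k}" w] less.hyps[of "S - {w}" k] gk gwk Sw k wS unfolding eq by auto
    then show "computable V E ord w (S - {w} - {k})" "computable V E ord k (S - {w} - {k})"
      unfolding eq by auto
    show "specified V E ord (Copula (Upair w k) (S - {w} - {k}))" using spec unfolding eq .
    show "k \<in> S - {w}" using k by auto
  qed
  show ?case
  proof (cases "\<exists>k\<in>S - {w}. \<forall>x\<in>S. (k, x) \<notin> E\<^sup>+")
    case True
    then obtain k where k: "k \<in> S" "k \<noteq> w" "\<And>x. x \<in> S \<Longrightarrow> (k, x) \<notin> E\<^sup>+" by auto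
    have gk: "good V E ord (S - {k})" using good_remove_sink[OF S k(1,3)] .
    have "good V E ord (S - {w} - {k})" using good_remove_sink[OF Sw, of k] k by auto
    moreover have eq: "S - {w} - {k} = S - {w, k}" by auto
    ultimately have gwk: "good V E ord (S - {w, k})" by simp
    have "specified V E ord (Copula (Upair w k) (S - {w, k}))"
    proof (cases "(w, k) \<in> E")
      case True
      have "pa E k \<inter> S - {w} = pa E k \<inter> (S - {w})" by auto
      then have "initial E ord k (pa E k \<inter> S - {w})" using goodD(3)[OF Sw, of k] k by auto
      then have "pa E k \<inter> S - {w} = pa_below E ord k w"
        using pa_below_last[OF admS[OF k(1)] goodD(3)[OF S k(1)]] True wS by (auto simp: pa_def)
      then show ?thesis
        using specified_arc[OF S admS k(1,3) wS True] by (simp add: insert_commute)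
    next
      case False
      have "Upair k w = Upair w k" by simp
      then show ?thesis
        using specified_dsep[OF S admS k(1,3) wS] k(2) False by (metis insert_commute)
    qed
    then show ?thesis using reduce[OF k(1,2) _ gk gwk] by blast
  next
    case False
    \<comment> \<open>By acyclicity some node of \<open>S\<close> has no descendants in
      \<open>S\<close>; in the present case it can only be \<open>w\<close>.\<close>
    obtain m where "m \<in> S" "\<And>x. (x, m) \<in> (E\<inverse>)\<^sup>+ \<Longrightarrow> x \<notin> S"
      using wfE_min[OF wf_trancl[OF wf_E_converse] wS] by blast
    then have m: "m \<in> S" "\<And>x. x \<in> S \<Longrightarrow> (m, x) \<notin> E\<^sup>+" by (auto simp: trancl_converse)
    then have w: "\<And>x. x \<in> S \<Longrightarrow> (w, x) \<notin> E\<^sup>+" using False by blast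
    have wV: "w \<in> V" using goodD(1)[OF S] wS by auto
    note aw = admS[OF wS]
    define P where "P = pa E w \<inter> S"
    have PS: "P \<subseteq> S - {w}" using no_cycle[of w] by (auto simp: P_def pa_def)
    have P: "initial E ord w P" using goodD(3)[OF S wS] by (simp add: P_def)
    show ?thesis
    proof (cases "S - {w} = {}")
      case True
      then show ?thesis using computable_empty by metis
    next
      case ne: False
      have "\<exists>k\<in>S - {w}. good V E ord (S - {w, k}) \<and> initial E ord w (P - {k}) \<and>
          (k \<in> P \<longrightarrow> P = S - {w}) \<and> specified V E ord (Copula (Upair w k) (S - {w, k}))"
      proof (cases "P = S - {w}")
        case True
        \<comment> \<open>\<open>k\<close> is the last parent, so its removal leaves an initial
          segment of the order of \<open>w\<close>.\<close>
        obtain k where k: "k \<in> P" "\<And>y. (k, y) \<in> ord w \<Longrightarrow> y \<notin> P"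
          using wfE_min[OF wf_ord(2)[OF aw], of _ P] ne True by auto
        have Pk: "initial E ord w (P - {k})"
          using P k(1,2) admissibleD(2)[OF aw] by (auto simp: initial_def)
        have eq: "S - {w, k} = P - {k}" using True by auto
        have "specified V E ord (Copula (Upair k w) (S - {w, k}))"
        proof (rule specified_arc[OF S admS wS w])
          show "pa E w \<inter> S - {k} = pa_below E ord w k"
            using pa_below_last[OF aw P Pk k(1)] by (simp add: P_def)
        qed (use k in \<open>auto simp: P_def pa_def\<close>)
        moreover have "Upair k w = Upair w k" by simp
        ultimately have "specified V E ord (Copula (Upair w k) (S - {w, k}))" by simp
        moreover have "good V E ord (S - {w, k})" unfolding eq by (rule admissibleD(5)[OF aw Pk])
        moreover have "k \<in> S - {w}" using k(1) True by simp
        ultimately show ?thesis using Pk True by blast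
      next
        case False
        have gP: "good V E ord P" using admissibleD(5)[OF aw P] .
        have "P \<subset> S - {w}" using PS False by auto
        \<comment> \<open>Such a \<open>k\<close> is not a parent of \<open>w\<close>, which makes
          the copula specified by d-separation.\<close>
        then have "\<exists>k\<in>S - {w} - P. good V E ord (S - {w} - {k})"
          by (rule good_predecessor[OF gP Sw _ admS]) simp
        then obtain k where k: "k \<in> S - {w} - P" "good V E ord (S - {w} - {k})" by blast
        have eq: "S - {w} - {k} = S - {w, k}" by auto
        have "P - {k} = P" using k by auto
        then have "initial E ord w (P - {k})" using P by simp
        moreover have "k \<in> S - {w}" "k \<notin> P" using k by auto
        moreover have "specified V E ord (Copula (Upair w k) (S - {w, k}))"
          by (rule specified_dsep[OF S admS wS w]) (use k in \<open>auto simp: P_def pa_def\<close>)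
        moreover have "good V E ord (S - {w, k})" using k(2) unfolding eq .
        ultimately show ?thesis by blast
      qed
      then obtain k where k: "k \<in> S" "k \<noteq> w" and gwk: "good V E ord (S - {w, k})"
          and Pk: "initial E ord w (P - {k})" and kP: "k \<in> P \<longrightarrow> P = S - {w}"
          and spec: "specified V E ord (Copula (Upair w k) (S - {w, k}))"
        by blast
      \<comment> \<open>Freeing \<open>k\<close> links \<open>w\<close> to nothing new. Unless
        \<open>a\<close> is a parent of \<open>w\<close>, \<open>k\<close> is not one; a trek
        through \<open>k\<close> would yield a trek between \<open>k\<close> and \<open>w\<close>
        avoiding \<open>S\<close>, hence an arc between them, but \<open>w\<close> has no children
        in \<open>S\<close> either.\<close>
      have adjw: "adjacent E w a" if a: "a \<in> S - {w, k}" and t: "trek E (S - {k}) w a" for a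
      proof (cases "a \<in> P")
        case True
        then show ?thesis by (auto simp: P_def pa_def adjacent_def)
      next
        case False
        then have kw: "(k, w) \<notin> E" using kP a k by (auto simp: P_def pa_def)
        have aS: "a \<in> S" "a \<noteq> w" "a \<noteq> k" using a by auto
        have Sk: "S - {k} \<union> {k} = S" "S - (S - {k}) = {k}" using k by auto
        have into: "dpath E S x w" if "dpath E (S - {k}) x w" for x
          using dpath_into[OF goodD(2)[OF S] wS _ that] kw Sk by auto
        have nk: "\<not> dpath E S k w" using dpath_arc[OF goodD(2)[OF S] k(1) wS] kw by auto
        have "trek E S w a"
        proof -
          consider "dpath E (S - {k}) w a" | "dpath E (S - {k}) a w" | "fork E (S - {k}) w a"
            using t by (auto simp: trek_def)
          then show ?thesis
          proof cases
            case 1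
            then show ?thesis using dpath_trancl[OF 1] w[OF aS(1)] by auto
          next
            case 2
            then show ?thesis using into by (auto simp: trek_def)
          next
            case 3
            then obtain u where u: "u \<notin> S - {k}" "dpath E (S - {k}) u w" "dpath E (S - {k}) u a"
              by (auto simp: fork_def)
            have uS: "u \<notin> S" using u(1) into[OF u(2)] nk by auto
            from dpath_first[OF u(3), of "{k}"] Sk consider "dpath E S u a" | "dpath E S u k"
              by auto
            then show ?thesis
            proof cases
              case 1
              then show ?thesis using uS into[OF u(2)] by (auto simp: trek_def fork_def)
            next
              case 2
              then have "trek E S w k" using uS into[OF u(2)] by (auto simp: trek_def fork_def)
              then have "(w, k) \<in> E"
                using treks_adjacentD[OF goodD(2)[OF S] wS k(1)] k(2) kw by auto
              then show ?thesis using w[OF k(1)] by auto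
            qed
          qed
        qed
        then show ?thesis using goodD(2)[OF S] wS aS by (auto simp: treks_adjacent_def)
      qed
      \<comment> \<open>Treks avoiding \<open>S - {k}\<close> also avoid \<open>S - {w, k}\<close>,
        so only pairs containing \<open>w\<close> need \<open>adjw\<close>.\<close>
      have "good V E ord (S - {k})"
        unfolding good_def
      proof (intro conjI ballI)
        show "S - {k} \<subseteq> V" using goodD(1)[OF S] by auto
        show "treks_adjacent E (S - {k})"
          unfolding treks_adjacent_def
        proof (intro ballI impI)
          fix a b assume ab: "a \<in> S - {k}" "b \<in> S - {k}" "a \<noteq> b" and t: "trek E (S - {k}) a b"
          have "trek E (S - {w, k}) a b" using trek_mono[OF t] by auto
          then show "adjacent E a b"
            using ab t adjw[of a] adjw[of b] trek_sym[OF t] adjacent_sym[of E w a] goodD(2)[OF gwk]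
            by (auto simp: treks_adjacent_def)
        qed
      next
        fix b assume b: "b \<in> S - {k}"
        show "initial E ord b (pa E b \<inter> (S - {k}))"
        proof (cases "b = w")
          case True
          moreover have "pa E w \<inter> (S - {k}) = P - {k}" by (auto simp: P_def)
          ultimately show ?thesis using Pk by simp
        next
          case False
          then have "pa E b \<inter> (S - {k}) = pa E b \<inter> (S - {w, k})"
            using w[of b] b by (auto simp: pa_def)
          then show ?thesis using goodD(3)[OF gwk, of b] b False by auto
        qed
      qed
      then show ?thesis using reduce[OF k spec _ gwk] by blast
    qed
  qed
qed

lemma good_insert_child:
  assumes adm: "admissible V E ord v" and v: "v \<in> V" and K: "initial E ord v K"
  shows "good V E ord (insert v K)"
proof -
  have KP: "K \<subseteq> pa E v" using K by (simp add: initial_def)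
  have gK: "good V E ord K" using admissibleD(5)[OF adm K] .
  have adjv: "adjacent E a v" "adjacent E v a" if "a \<in> K" for a
    using KP that by (auto simp: adjacent_def pa_def)
  have "treks_adjacent E (insert v K)"
    unfolding treks_adjacent_def
  proof (intro ballI impI)
    fix a b assume ab: "a \<in> insert v K" "b \<in> insert v K" "a \<noteq> b" and t: "trek E (insert v K) a b"
    have "trek E K a b" using trek_mono[OF t] by auto
    then show "adjacent E a b"
      using ab adjv goodD(2)[OF gK] by (auto simp: treks_adjacent_def)
  qed
  moreover have "initial E ord b (pa E b \<inter> insert v K)" if b: "b \<in> insert v K" for b
  proof (cases "b = v")
    case True
    have "pa E v \<inter> insert v K = K" using KP no_cycle[of v] by (auto simp: pa_def)
    then show ?thesis using True K by simp
  next
    case False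
    then have "b \<in> K" using b by auto
    then have "v \<notin> pa E b" using KP asym[of b v] by (auto simp: pa_def)
    then have "pa E b \<inter> insert v K = pa E b \<inter> K" by auto
    then show ?thesis using goodD(3)[OF gK \<open>b \<in> K\<close>] by simp
  qed
  ultimately show ?thesis using v goodD(1)[OF gK] by (simp add: good_def)
qed

lemma density_computable:
  assumes adm: "\<And>v. v \<in> V \<Longrightarrow> admissible V E ord v"
  shows "\<not> density_requires_integration V E ord"
proof -
  have "computable V E ord w (pa_below E ord v w) \<and> computable V E ord v (pa_below E ord v w)"
    if v: "v \<in> V" and w: "w \<in> pa E v" for v w
  proof -
    define K where "K = pa_below E ord v w"
    note av = adm[OF v]
    have K: "initial E ord v K" "initial E ord v (insert w K)"
      using initial_pa_below[OF av w] by (auto simp: K_def)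
    have "w \<notin> K" using admissibleD(2)[OF av] by (auto simp: K_def pa_below_def)
    moreover have "v \<notin> K" using no_cycle[of v] by (auto simp: K_def pa_below_def pa_def)
    ultimately have eq: "insert w K - {w} = K" "insert v K - {v} = K" by auto
    have "computable V E ord w (insert w K - {w})"
      by (rule computable_good[OF adm]) (use eq admissibleD(5)[OF av] K in auto)
    moreover have "computable V E ord v (insert v K - {v})"
      by (rule computable_good[OF adm])
        (use eq admissibleD(5)[OF av] K good_insert_child[OF av v] in auto)
    ultimately have "computable V E ord w K \<and> computable V E ord v K" unfolding eq ..
    then show ?thesis unfolding K_def .
  qed
  then show ?thesis
    unfolding density_requires_integration_def density_margins_def by blast
qed

end

section \<open>Necessity\<close>

text \<open>The pair \<open>v\<close>, \<open>k\<close> occurs at the root; any other pair omits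
  \<open>v\<close> or \<open>k\<close> and is found in one of the two sub-recursions.\<close>

lemma recursion_copula:
  assumes "is_recursion x K R" "a \<noteq> b" "a \<in> insert x K" "b \<in> insert x K"
  shows "\<exists>L \<subseteq> insert x K. Copula (Upair a b) L \<in> copulas_of R"
  using assms
proof (induction rule: is_recursion.induct)
  case (2 k K v Rv Rk)
  consider "Upair a b = Upair v k" | "a \<in> insert v (K - {k})" "b \<in> insert v (K - {k})"
    | "a \<in> insert k (K - {k})" "b \<in> insert k (K - {k})"
    using 2 by auto
  then show ?case
  proof cases
    case 1
    then show ?thesis by (intro exI[of _ "K - {k}"]) auto
  next
    case 2
    then obtain L where "L \<subseteq> insert v (K - {k})" "Copula (Upair a b) L \<in> copulas_of Rv"
      using "2.IH"(1) "2.prems"(1) by auto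
    then show ?thesis by (intro exI[of _ L]) auto
  next
    case 3
    then obtain L where "L \<subseteq> insert k (K - {k})" "Copula (Upair a b) L \<in> copulas_of Rk"
      using "2.IH"(2) "2.prems"(1) by auto
    then show ?thesis using "2.hyps"(1) by (intro exI[of _ L]) auto
  qed
qed auto

lemma computable_specified:
  assumes "computable V E ord x K" "a \<noteq> b" "a \<in> insert x K" "b \<in> insert x K"
  shows "\<exists>L \<subseteq> insert x K. specified V E ord (Copula (Upair a b) L)"
proof -
  obtain R where R: "is_recursion x K R" "proper V E ord R"
    using assms(1) by (auto simp: recursions_def)
  from recursion_copula[OF R(1) assms(2-4)] R(2) show ?thesis
    unfolding proper_def by blast
qed

lemma dsep_not_adjacent:
  assumes "acyclic E" "adjacent E a b" "a \<notin> Z" "b \<notin> Z"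
  shows "\<not> dsep E {a} {b} Z"
proof -
  have "a \<noteq> b" using assms(1,2) by (auto simp: adjacent_def acyclic_def)
  then have "trail E [a, b]" using assms(2) by (simp add: trail_def)
  moreover have "\<not> blocked E [a, b] Z"
    using assms(3,4) by (auto simp: blocked_def converging_at_def less_Suc_eq)
  ultimately show ?thesis by (fastforce simp: dsep_def)
qed

text \<open>Adjacent nodes are never d-separated, which leaves clauses (i) and (iii), and acyclicity
  fixes the naming of the pair.\<close>

lemma specified_arcD:
  assumes "acyclic E" "(a, b) \<in> E" "specified V E ord (Copula (Upair a b) L)"
  shows "pa_below E ord b a \<subseteq> L"
proof -
  obtain w v where wv: "Upair a b = Upair w v" "L \<subseteq> V - {w, v}"
      and c: "(w, v) \<in> E \<and> pa_below E ord v w \<subseteq> L \<or> dsep E {w} {v} L"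
    using assms(3) unfolding specified_def by auto
  have "\<not> dsep E {w} {v} L"
    using dsep_not_adjacent[OF assms(1), of w v L] wv assms(2) by (auto simp: adjacent_def)
  moreover have "(b, a) \<notin> E"
    using assms(1,2) trancl_into_trancl[of a b E a] by (auto simp: acyclic_def)
  ultimately show ?thesis using wv(1) c by auto
qed

lemma density_computable_margins:
  assumes "\<not> density_requires_integration V E ord" "v \<in> V" "w \<in> pa E v"
  shows "computable V E ord w (pa_below E ord v w)"
  using assms unfolding density_requires_integration_def density_margins_def by blast

lemma parental_orders_total:
  assumes "parental_orders V E ord" "v \<in> V" "a \<in> pa E v" "b \<in> pa E v" "a \<noteq> b"
  shows "(a, b) \<in> ord v \<or> (b, a) \<in> ord v"
  using assms by (auto simp: parental_orders_def strict_linear_order_on_def total_on_def)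

text \<open>Of \<open>v1\<close> and \<open>v2\<close>, the one that comes first in the order of
  \<open>v3\<close> is forced to be a parent of both \<open>v4\<close> and
  \<open>v5\<close>.\<close>

lemma no_interfering_if_computable:
  assumes dag: "dag V E" and ord: "parental_orders V E ord"
    and dens: "\<not> density_requires_integration V E ord"
  shows "\<not> has_interfering_v_structures V E"
proof
  assume "has_interfering_v_structures V E"
  then obtain v1 v2 v3 v4 v5 where v: "v3 \<in> V" "v4 \<in> V" "v5 \<in> V"
      "(v3, v4) \<in> E" "(v3, v5) \<in> E" "(v1, v3) \<in> E" "(v1, v4) \<in> E" "(v1, v5) \<notin> E"
      "(v2, v3) \<in> E" "(v2, v5) \<in> E" "(v2, v4) \<notin> E"
    unfolding has_interfering_v_structures_def by blast
  have acyc: "acyclic E" using dag by (simp add: dag_def)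
  have inherits: "(a, u) \<in> E"
    if "(a, b) \<in> ord v3" "(a, v3) \<in> E" "(b, v3) \<in> E" "(v3, u) \<in> E" "(b, u) \<in> E" "u \<in> V" for a b u
  proof -
    have "b \<noteq> v3" using that acyc by (auto simp: acyclic_def)
    have pa: "v3 \<in> pa E u" "b \<in> pa E u" using that by (auto simp: pa_def)
    then have "(v3, b) \<in> ord u \<or> (b, v3) \<in> ord u"
      using parental_orders_total[OF ord that(6)] \<open>b \<noteq> v3\<close> by blast
    \<comment> \<open>\<open>x\<close> is the later of \<open>v3\<close> and \<open>b\<close> in the
      order of \<open>u\<close>. The margin of \<open>x\<close> needs a copula of \<open>b\<close>
      and \<open>v3\<close> whose conditioning set consists of parents of \<open>u\<close>; as this
      copula belongs to an arc, the set contains \<open>a\<close>.\<close>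
    then obtain x where x: "x \<in> pa E u" "v3 \<in> insert x (pa_below E ord u x)"
        "b \<in> insert x (pa_below E ord u x)"
      using pa unfolding pa_below_def by blast
    have "computable V E ord x (pa_below E ord u x)"
      using density_computable_margins[OF dens that(6) x(1)] .
    from computable_specified[OF this \<open>b \<noteq> v3\<close> x(3,2)]
    obtain L where L: "L \<subseteq> insert x (pa_below E ord u x)"
        "specified V E ord (Copula (Upair b v3) L)"
      by blast
    have "a \<in> pa_below E ord v3 b" using that by (auto simp: pa_below_def pa_def)
    then have "a \<in> L" using specified_arcD[OF acyc that(3) L(2)] by auto
    then show ?thesis using L(1) x(1) by (auto simp: pa_below_def pa_def)
  qed
  have "v1 \<noteq> v2" using v by auto
  then have "(v1, v2) \<in> ord v3 \<or> (v2, v1) \<in> ord v3"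
    using parental_orders_total[OF ord v(1), of v1 v2] v by (auto simp: pa_def)
  then show False
  proof
    assume "(v1, v2) \<in> ord v3"
    from inherits[OF this v(6,9,5,10,3)] v(8) show False by simp
  next
    assume "(v2, v1) \<in> ord v3"
    from inherits[OF this v(9,6,4,7,2)] v(11) show False by simp
  qed
qed

section \<open>Symmetry of d-separation\<close>

lemma blocked_rev:
  assumes "blocked E (rev p) Z"
  shows "blocked E p Z"
proof -
  obtain i where i: "i < length p"
      "(converging_at E (rev p) i \<and> ({rev p ! i} \<union> de E (rev p ! i)) \<inter> Z = {}) \<or>
       (\<not> converging_at E (rev p) i \<and> rev p ! i \<in> Z)"
    using assms by (auto simp: blocked_def)
  define j where "j = length p - Suc i"
  have j: "j < length p" "rev p ! i = p ! j" using i(1) by (auto simp: j_def rev_nth)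
  have "converging_at E (rev p) i \<longleftrightarrow> converging_at E p j"
  proof (cases "0 < i \<and> Suc i < length p")
    case True
    then have "rev p ! (i - 1) = p ! Suc j" "rev p ! Suc i = p ! (j - 1)" "0 < j" "Suc j < length p"
      by (auto simp: j_def rev_nth Suc_diff_Suc)
    then show ?thesis using True j by (auto simp: converging_at_def)
  next
    case False
    then have "\<not> (0 < j \<and> Suc j < length p)" using i(1) by (auto simp: j_def)
    then show ?thesis using False by (auto simp: converging_at_def)
  qed
  then show ?thesis using i(2) j unfolding blocked_def by (intro exI[of _ j]) simp
qed

lemma trail_rev: "trail E p \<Longrightarrow> trail E (rev p)"
proof -
  assume p: "trail E p"
  have sym: "(\<lambda>x y. adjacent E y x) = adjacent E" by (auto simp: fun_eq_iff adjacent_def)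
  have "successively (\<lambda>x y. adjacent E y x) p" unfolding sym using p by (simp add: trail_def)
  then show "trail E (rev p)" using p by (simp add: trail_def)
qed

lemma dsep_sym: "dsep E S Y Z \<Longrightarrow> dsep E Y S Z"
  unfolding dsep_def
proof (intro allI impI)
  fix p
  assume *: "\<forall>p. trail E p \<and> hd p \<in> S \<and> last p \<in> Y \<longrightarrow> blocked E p Z"
    and p: "trail E p \<and> hd p \<in> Y \<and> last p \<in> S"
  then have "p \<noteq> []" by (auto simp: trail_def)
  then have "trail E (rev p) \<and> hd (rev p) \<in> S \<and> last (rev p) \<in> Y"
    using p trail_rev[of E p] by (simp add: hd_rev last_rev)
  then have "blocked E (rev p) Z" using * by blast
  then show "blocked E p Z" by (rule blocked_rev)
qed

text \<open>The margin of the later of \<open>w\<close> and \<open>z\<close> in the order of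
  \<open>v\<close> needs a copula of this pair given a set \<open>L\<close> of parents of
  \<open>v\<close>. Without an arc between them, \<open>L\<close> must d-separate them; but the
  trail of the cycle has no collider and, for lack of chords, no interior node among the parents of
  \<open>v\<close>.\<close>

lemma no_active_cycle_if_computable:
  assumes dag: "dag V E" and ord: "parental_orders V E ord"
    and dens: "\<not> density_requires_integration V E ord"
  shows "\<not> has_active_cycle V E"
proof
  assume "has_active_cycle V E"
  then obtain v w z xs where v: "v \<in> V" "w \<in> pa E v" "z \<in> pa E v" "w \<noteq> z" "xs \<noteq> []"
      and p: "trail E (w # xs @ [z])" "\<And>i. \<not> converging_at E (w # xs @ [z]) i"
      and chord: "\<not> closed_trail_has_chord E (v # w # xs @ [z])"
    unfolding has_active_cycle_def by blast
  have nadj: "\<not> adjacent E w z"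
  proof
    assume "adjacent E w z"
    then have "closed_trail_has_chord E (v # w # xs @ [z])"
      unfolding closed_trail_has_chord_def using v(5)
      \<comment> \<open>These are the positions of \<open>w\<close> and \<open>z\<close> in the
        closed trail; \<open>xs\<close> being nonempty makes them non-consecutive.\<close>
      by (intro exI[of _ 1] exI[of _ "Suc (Suc (length xs))"]) (auto simp: nth_append)
    then show False using chord by simp
  qed
  have xs_pa: "x \<notin> pa E v" if x: "x \<in> set xs" for x
  proof
    assume "x \<in> pa E v"
    then have "adjacent E v x" by (auto simp: adjacent_def pa_def)
    moreover obtain i where "i < length xs" "x = xs ! i" using x by (auto simp: in_set_conv_nth)
    ultimately have "closed_trail_has_chord E (v # w # xs @ [z])"
      unfolding closed_trail_has_chord_def
      by (intro exI[of _ 0] exI[of _ "Suc (Suc i)"]) (auto simp: nth_append)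
    then show False using chord by simp
  qed
  have "(w, z) \<in> ord v \<or> (z, w) \<in> ord v" using parental_orders_total[OF ord v(1-4)] .
  then obtain x where x: "x \<in> pa E v" "w \<in> insert x (pa_below E ord v x)"
      "z \<in> insert x (pa_below E ord v x)"
    using v(2,3) unfolding pa_below_def by blast
  have "computable V E ord x (pa_below E ord v x)"
    using density_computable_margins[OF dens v(1) x(1)] .
  from computable_specified[OF this v(4) x(2,3)]
  obtain L where L: "L \<subseteq> insert x (pa_below E ord v x)" "specified V E ord (Copula (Upair w z) L)"
    by blast
  obtain a b where ab: "Upair w z = Upair a b" "L \<subseteq> V - {a, b}" "(a, b) \<in> E \<or> dsep E {a} {b} L"
    using L(2) unfolding specified_def by auto
  then have "dsep E {w} {z} L"
    using nadj dsep_sym[of E "{z}" "{w}" L] by (auto simp: adjacent_def)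
  then have "blocked E (w # xs @ [z]) L" using p(1) by (auto simp: dsep_def)
  then obtain y where y: "y \<in> set (w # xs @ [z])" "y \<in> L"
    using p(2) nth_mem unfolding blocked_def by metis
  have "w \<notin> L" "z \<notin> L" using ab by auto
  then have "y \<in> set xs" using y by auto
  moreover have "y \<in> pa E v" using y(2) L(1) x(1) by (auto simp: pa_below_def)
  ultimately show False using xs_pa by simp
qed

theorem theorem4p1:
  fixes V :: "'a set" and E :: "'a rel"
  assumes "dag V E"
  shows "(\<exists>ord. parental_orders V E ord \<and> \<not> density_requires_integration V E ord) \<longleftrightarrow>
         \<not> has_active_cycle V E \<and> \<not> has_interfering_v_structures V E"
proof
  assume "\<exists>ord. parental_orders V E ord \<and> \<not> density_requires_integration V E ord"
  then show "\<not> has_active_cycle V E \<and> \<not> has_interfering_v_structures V E"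
    using no_active_cycle_if_computable[OF assms] no_interfering_if_computable[OF assms] by auto
next
  assume "\<not> has_active_cycle V E \<and> \<not> has_interfering_v_structures V E"
  then interpret integrable_dag V E
    using assms by unfold_locales auto
  obtain ord where adm: "\<And>v. v \<in> V \<Longrightarrow> admissible V E ord v"
    using exists_admissible_orders by auto
  then have "parental_orders V E ord" by (simp add: parental_orders_def admissible_def)
  then show "\<exists>ord. parental_orders V E ord \<and> \<not> density_requires_integration V E ord"
    using density_computable[OF adm] by blast
qed

end
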